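(* Let $\mathcal{M}$ be a family of nondegenerate probability distributions on $\mathbb{R}$ with finite first moment, viewed as a metric space under the $1$-Wasserstein distance $W_1$; let $G_0\in\mathcal{M}$, and let $H_0$ be a probability distribution on $(0,\infty)$. For each $n$, let $(\mu_i,\sigma_i)\sim G_0\times H_0$ independently for $i=1,\dots,n$, and $X_i\mid\mu_i,\sigma_i\sim\mathcal{N}(\mu_i,\sigma_i^2)$ independently across $i$. Let $m=m_n<n$ be integers with $m/n\to\alpha\in(0,1)$, and let $\widehat G=\widehat G(X_1,\dots,X_n,\sigma_1,\dots,\sigma_n)\in\mathcal{M}$ be an estimator of $G_0$. Assume: 1. $W_1(\widehat G,G_0)=\mathcal{O}_p(r_n)$ for some sequence $(r_n)_{n\in\mathbb{N}}$ with $r_n\ge n^{-1/2}$ for all $n$ and $r_n\to 0$; 2. the support of $H_0$ is compact and bounded away from $0$. Then the regret $\mathcal{R}$ of empirical Bayes top-$m$ selection relative to oracle Bayes top-$m$ selection satisfies $\mathcal{R}=\mathcal{O}_p(r_n^2)$ as $n\to\infty$.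
   Context: $\phi$ is the standard Gaussian density. For a distribution $G$ and $\sigma>0$, the posterior mean function is $$f_{G,\sigma}(x)=\frac{\int \mu\,\frac1\sigma\phi\left(\frac{x-\mu}{\sigma}\right)dG(\mu)}{\int \frac1\sigma\phi\left(\frac{x-\mu}{\sigma}\right)dG(\mu)}.$$ Put $\theta_i=f_{G_0,\sigma_i}(X_i)$ (oracle Bayes posterior mean, equal to $\mathbb{E}[\mu_i\mid X_i,\sigma_i]$) and $\widehat\theta_i=f_{\widehat G,\sigma_i}(X_i)$ (empirical Bayes posterior mean). $J_{\mathrm{Bayes}}\subset\{1,\dots,n\}$ is the set of indices of the $m$ largest $\theta_i$, and $J_{\mathrm{EB}}$ is the set of indices of the $m$ largest $\widehat\theta_i$, ties broken randomly in both cases. The regret is $$\mathcal{R}=\frac1n\sum_{i=1}^n\left(\mathds{1}(i\in J_{\mathrm{Bayes}})-\mathds{1}(i\in J_{\mathrm{EB}})\right)\theta_i .$$ $Y_n=\mathcal{O}_p(a_n)$ means that $Y_n/a_n$ is bounded in probability: for every $\varepsilon>0$ there are $M,N$ such that $\mathbb{P}(|Y_n/a_n|>M)<\varepsilon$ for all $n>N$. *)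

theory Defs
  imports "HOL-Probability.Probability" "HOL-Combinatorics.Permutations"
begin

definition couplings :: "real measure \<Rightarrow> real measure \<Rightarrow> (real \<times> real) measure set" where
  "couplings G G' =
     {\<pi>. sets \<pi> = sets (borel \<Otimes>\<^sub>M borel) \<and> distr \<pi> borel fst = G \<and> distr \<pi> borel snd = G'}"

(* Only meant for probability distributions with finite first moment: every coupling of two such
   distributions has a finite cost, so neither the Bochner integral nor the real-valued
   infimum takes a default value. *)
definition W1 :: "real measure \<Rightarrow> real measure \<Rightarrow> real" where
  "W1 G G' = (INF \<pi>\<in>couplings G G'. LINT z|\<pi>. \<bar>fst z - snd z\<bar>)"

(* A distribution is nondegenerate if it is not a point mass. *)
definition nondegenerate_W1_distributions :: "real measure set" where
  "nondegenerate_W1_distributions =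
     {G. real_distribution G \<and> integrable G (\<lambda>x. x) \<and> \<not> (\<exists>a. G = return borel a)}"

(* The Borel sigma-algebra of the metric space (F, W1). *)
definition W1_borel :: "real measure set \<Rightarrow> real measure measure" where
  "W1_borel F =
     sigma F {U. U \<subseteq> F \<and> (\<forall>G\<in>U. \<exists>\<epsilon>>0. \<forall>G'\<in>F. W1 G G' < \<epsilon> \<longrightarrow> G' \<in> U)}"

definition measure_support :: "real measure \<Rightarrow> real set" where
  "measure_support H = {x. \<forall>U. open U \<longrightarrow> x \<in> U \<longrightarrow> emeasure H U > 0}"

definition posterior_mean :: "real measure \<Rightarrow> real \<Rightarrow> real \<Rightarrow> real" where
  "posterior_mean G \<sigma> x =
     (LINT \<mu>|G. \<mu> * (1 / \<sigma> * std_normal_density ((x - \<mu>) / \<sigma>))) /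
     (LINT \<mu>|G. 1 / \<sigma> * std_normal_density ((x - \<mu>) / \<sigma>))"

(* The law of a triple (mu, sigma, X) with (mu, sigma) distributed as G x H and, given
   (mu, sigma), X normal with mean mu and standard deviation sigma. The density is only
   relevant for sigma > 0, as H will be concentrated on the positive half-line. *)
definition hierarchical_law :: "real measure \<Rightarrow> real measure \<Rightarrow> (real \<times> real \<times> real) measure" where
  "hierarchical_law G H =
     density (G \<Otimes>\<^sub>M H \<Otimes>\<^sub>M lborel) (\<lambda>(\<mu>, \<sigma>, x). ennreal (normal_density \<mu> \<sigma> x))"

(* The indices of the m largest of t 1, ..., t n. Index j is ranked before i if t j > t i; among
   tied indices the one with the smaller priority p comes first. Drawing p uniformly among the
   permutations of {1..n} breaks the ties at random. *)
definition top_indices :: "nat \<Rightarrow> nat \<Rightarrow> (nat \<Rightarrow> real) \<Rightarrow> (nat \<Rightarrow> nat) \<Rightarrow> nat set" where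
  "top_indices n m t p =
     {i\<in>{1..n}. card {j\<in>{1..n}. t j > t i \<or> t j = t i \<and> p j < p i} < m}"

lemma top_indices_correct:
  assumes p: "p permutes {1..n}" and m: "m \<le> n"
  shows "card (top_indices n m t p) = m"
    and "\<And>i j. i \<in> top_indices n m t p \<Longrightarrow> j \<in> {1..n} - top_indices n m t p \<Longrightarrow> t j \<le> t i"
proof -
  define B where "B i = {j\<in>{1..n}. t j > t i \<or> t j = t i \<and> p j < p i}" for i
  have fin: "finite (B i)" for i by (simp add: B_def)
  have mono: "card (B j) < card (B i)"
    if "j \<in> {1..n}" "t j > t i \<or> t j = t i \<and> p j < p i" for i j
  proof (rule psubset_card_mono[OF fin])
    have "B j \<subseteq> B i" using that by (auto simp: B_def)
    moreover have "j \<in> B i" "j \<notin> B j" using that by (auto simp: B_def)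
    ultimately show "B j \<subset> B i" by blast
  qed
  have total: "i = j \<or> (t j > t i \<or> t j = t i \<and> p j < p i) \<or> (t i > t j \<or> t i = t j \<and> p i < p j)"
    for i j
  proof -
    have "p i = p j \<Longrightarrow> i = j" by (rule injD[OF permutes_inj[OF p]])
    then show ?thesis using less_linear[of "t i" "t j"] less_linear[of "p i" "p j"] by metis
  qed
  have inj: "inj_on (\<lambda>i. card (B i)) {1..n}"
  proof (rule inj_onI)
    fix i j assume "i \<in> {1..n}" "j \<in> {1..n}" "card (B i) = card (B j)"
    then show "i = j" using total[of i j] mono[of i j] mono[of j i] by (metis less_irrefl)
  qed
  have "card (B i) < n" if "i \<in> {1..n}" for i
  proof -
    have "B i \<subseteq> {1..n}" "i \<notin> B i" by (auto simp: B_def)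
    with that have "B i \<subset> {1..n}" by blast
    from psubset_card_mono[OF finite_atLeastAtMost this] show ?thesis by simp
  qed
  then have sub: "(\<lambda>i. card (B i)) ` {1..n} \<subseteq> {..<n}" by blast
  have "card ((\<lambda>i. card (B i)) ` {1..n}) = card {..<n}"
    using inj by (simp only: card_image) simp
  then have "(\<lambda>i. card (B i)) ` {1..n} = {..<n}"
    by (intro card_subset_eq[OF _ sub]) simp_all
  moreover have "(\<lambda>i. card (B i)) ` {i\<in>{1..n}. card (B i) < m} = (\<lambda>i. card (B i)) ` {1..n} \<inter> {..<m}"
    by blast
  ultimately have "(\<lambda>i. card (B i)) ` {i\<in>{1..n}. card (B i) < m} = {..<m}"
    using m by (simp only:) (rule Int_absorb1, simp)
  moreover have "inj_on (\<lambda>i. card (B i)) {i\<in>{1..n}. card (B i) < m}"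
    by (rule inj_on_subset[OF inj]) auto
  ultimately have "card {i\<in>{1..n}. card (B i) < m} = m"
    by (metis card_image card_lessThan)
  then show "card (top_indices n m t p) = m"
    by (simp add: top_indices_def B_def)
  fix i j assume "i \<in> top_indices n m t p" "j \<in> {1..n} - top_indices n m t p"
  then have "card (B i) < card (B j)" "j \<in> {1..n}" by (auto simp: top_indices_def B_def)
  then show "t j \<le> t i" using mono[of j i] by force
qed

(* A uniformly random permutation of {1..n} that is independent of the random family Z: the joint
   law is a product (indep_var needs both variables to have the same type). *)
definition random_permutation ::
    "'w measure \<Rightarrow> nat \<Rightarrow> ('w \<Rightarrow> nat \<Rightarrow> real \<times> real \<times> real) \<Rightarrow> ('w \<Rightarrow> nat \<Rightarrow> nat) \<Rightarrow> bool" where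
  "random_permutation P n Z \<tau> \<longleftrightarrow>
     (let S = {p. p permutes {1..n}}; D = (\<Pi>\<^sub>M i\<in>{1..n}. borel) in
      \<tau> \<in> P \<rightarrow>\<^sub>M count_space S \<and>
      distr P (D \<Otimes>\<^sub>M count_space S) (\<lambda>\<omega>. (Z \<omega>, \<tau> \<omega>)) = distr P D Z \<Otimes>\<^sub>M uniform_count_measure S)"

(* t: oracle values, t': estimated values; p, p': the respective tie-breaking priorities *)
definition regret ::
    "nat \<Rightarrow> nat \<Rightarrow> (nat \<Rightarrow> real) \<Rightarrow> (nat \<Rightarrow> real) \<Rightarrow> (nat \<Rightarrow> nat) \<Rightarrow> (nat \<Rightarrow> nat) \<Rightarrow> real" where
  "regret n m t t' p p' =
     1 / real n * (\<Sum>i=1..n. (indicator (top_indices n m t p) i - indicator (top_indices n m t' p') i) * t i)"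

(* Stochastic boundedness for a sequence indexed by n >= 1. The n-th variable may live on its own
   probability space. Measurability is part of the notion: measure is 0 on sets
   that are not measurable. *)
definition bigO_prob ::
    "(nat \<Rightarrow> 'w measure) \<Rightarrow> (nat \<Rightarrow> 'w \<Rightarrow> real) \<Rightarrow> (nat \<Rightarrow> real) \<Rightarrow> bool" where
  "bigO_prob P Y a \<longleftrightarrow>
     (\<forall>n\<ge>1. Y n \<in> borel_measurable (P n)) \<and>
     (\<forall>\<epsilon>>0. \<exists>M N. \<forall>n>N. measure (P n) {\<omega>\<in>space (P n). \<bar>Y n \<omega> / a n\<bar> > M} < \<epsilon>)"

end

theory Submission
  imports Defs
begin

text \<open>
  For fixed \<open>s\<close> the posterior mean increases in \<open>x\<close>, strictly on compact sets because the prior is not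
  a point mass, and it approaches the ends of the prior's support as \<open>x\<close> tends to infinity in either direction.
  As \<open>0 < \<alpha> < 1\<close>, the oracle threshold therefore lies in the interior of its range, and with high probability
  the two selections agree on all indices with \<open>\<bar>X\<^sub>i\<bar> > K\<close>. For \<open>\<bar>X\<^sub>i\<bar> \<le> K\<close> the posterior mean is Lipschitz in the
  prior for the Wasserstein distance, so the estimated values err by at most \<open>\<eta> = O(r\<^sub>n)\<close>: every pair of
  indices that is exchanged has oracle values within \<open>2\<eta>\<close> of each other, and all of these values lie in one window of
  length \<open>2\<eta>\<close>. The regret is thus at most \<open>2\<eta>\<close> times the fraction of oracle values in a window of length
  \<open>O(r\<^sub>n)\<close>. This fraction is \<open>O(r\<^sub>n)\<close> uniformly over windows: the real line is cut into cells of length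
  \<open>r\<^sub>n\<close>, each of probability \<open>O(r\<^sub>n)\<close>, and the squared deviations of the cell counts, summed over all cells,
  have expectation at most \<open>n \<le> (n r\<^sub>n)\<^sup>2\<close>.
\<close>

subsection \<open>Wasserstein distance and the Gaussian likelihood\<close>

text \<open>The cutoff \<open>K\<close> is forced: the marginal density that divides the posterior
  mean has no positive lower bound over all \<open>x\<close>, and the slope of the posterior mean
  may vanish at infinity. Beyond \<open>K\<close> the oracle and the estimated posterior mean need
  not be close. There only the monotonicity of the estimated one is used: it carries what is known
  at \<open>K\<close> and \<open>-K\<close>, where the Lipschitz bound still applies, to the whole
  tail. Uniformity over windows is needed because the estimate is computed from the very sample that
  is ranked, so the window that collects the exchanged indices depends on all observations. Plain
  second moments suffice: the variances of counts of disjoint cells add up to a bound that does not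
  grow with the number of cells, so no union bound over roughly 1 / r cells has to be paid
  for.\<close>

lemma normal_density_kernel:
  assumes "s > 0"
  shows "1 / s * std_normal_density ((x - \<mu>) / s) = normal_density \<mu> s x"
  using assms by (simp add: normal_density_def real_sqrt_mult power_divide mult_ac)

lemma posterior_mean_normal_density:
  assumes "s > 0"
  shows "posterior_mean G s x =
    (LINT \<mu>|G. \<mu> * normal_density \<mu> s x) / (LINT \<mu>|G. normal_density \<mu> s x)"
  unfolding posterior_mean_def normal_density_kernel[OF assms] ..

lemma normal_density_exp:
  assumes "s > 0"
  shows "normal_density \<mu> s x = 1 / (s * sqrt (2 * pi)) * exp (- ((x - \<mu>) / s)\<^sup>2 / 2)"
  using assms by (simp add: normal_density_def real_sqrt_mult power_divide mult_ac)

lemma one_le_sqrt_2pi: "1 \<le> sqrt (2 * pi)"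
  using pi_gt3 by (intro real_le_rsqrt) simp

text \<open>The Gaussian factor absorbs every \<open>v \<le> w * exp (u\<^sup>2 / 2)\<close>, and
  exp y \<ge> 1 + y supplies such a bound for 1, for \<bar>u\<bar> and for the square of
  \<open>u\<close>. These three moments of the standardized residual are what the derivatives of the
  density and of mean times density produce.\<close>

lemma normal_density_bounds:
  assumes s: "s > 0"
  shows "normal_density \<mu> s x \<le> 1 / s"
    and "normal_density \<mu> s x * \<bar>(x - \<mu>) / s\<bar> \<le> 1 / s"
    and "normal_density \<mu> s x * ((x - \<mu>) / s)\<^sup>2 \<le> 2 / s"
proof -
  define u where "u = (x - \<mu>) / s"
  have c: "0 \<le> 1 / (s * sqrt (2 * pi))" "1 / (s * sqrt (2 * pi)) \<le> 1 / s"
    using s one_le_sqrt_2pi by (auto simp: field_simps)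
  have main: "normal_density \<mu> s x * v \<le> w / s" if "0 \<le> v" "v \<le> w * exp (u\<^sup>2 / 2)" for v w
  proof -
    have "exp (- u\<^sup>2 / 2) * v \<le> exp (- u\<^sup>2 / 2) * (w * exp (u\<^sup>2 / 2))"
      using that by (intro mult_left_mono) auto
    also have "\<dots> = w" by (simp add: exp_minus field_simps)
    finally have *: "exp (- u\<^sup>2 / 2) * v \<le> w" .
    have "normal_density \<mu> s x * v = 1 / (s * sqrt (2 * pi)) * (exp (- u\<^sup>2 / 2) * v)"
      using s by (simp add: normal_density_exp u_def)
    also have "\<dots> \<le> 1 / s * w"
      using c * that s by (intro mult_mono) auto
    finally show ?thesis by simp
  qed
  have e: "1 + u\<^sup>2 / 2 \<le> exp (u\<^sup>2 / 2)" by (rule exp_ge_add_one_self)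
  show "normal_density \<mu> s x \<le> 1 / s" using main[of 1 1] by simp
  have "\<bar>u\<bar> \<le> 1 + u\<^sup>2 / 2"
    using zero_le_power2[of "\<bar>u\<bar> - 1"] by (simp add: power2_diff)
  then have "\<bar>u\<bar> \<le> 1 * exp (u\<^sup>2 / 2)" using e by linarith
  from main[OF abs_ge_zero this] show "normal_density \<mu> s x * \<bar>(x - \<mu>) / s\<bar> \<le> 1 / s"
    by (simp only: u_def)
  have "u\<^sup>2 \<le> 2 * exp (u\<^sup>2 / 2)" using e by linarith
  from main[OF zero_le_power2 this] show "normal_density \<mu> s x * ((x - \<mu>) / s)\<^sup>2 \<le> 2 / s"
    by (simp only: u_def)
qed

lemma DERIV_normal_density_mean:
  assumes "s > 0"
  shows "((\<lambda>\<mu>. normal_density \<mu> s x) has_real_derivative normal_density \<mu> s x * ((x - \<mu>) / s / s)) (at \<mu>)"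
proof -
  have "((\<lambda>\<mu>. C * exp (- ((x - \<mu>) / s)\<^sup>2 / 2)) has_real_derivative
      C * exp (- ((x - \<mu>) / s)\<^sup>2 / 2) * ((x - \<mu>) / s / s)) (at \<mu>)" for C
    using assms by (auto intro!: derivative_eq_intros simp: field_simps power2_eq_square)
  from this[of "1 / (s * sqrt (2 * pi))"] show ?thesis
    using assms by (simp add: normal_density_exp)
qed

lemma normal_density_lipschitz:
  assumes c: "0 < c" "c \<le> s"
  shows "\<bar>normal_density \<mu> s x - normal_density \<nu> s x\<bar> \<le> 1 / c\<^sup>2 * \<bar>\<mu> - \<nu>\<bar>"
proof -
  have s: "s > 0" using c by simp
  have "norm (normal_density \<mu> s x - normal_density \<nu> s x) \<le> 1 / c\<^sup>2 * norm (\<mu> - \<nu>)"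
  proof (rule field_differentiable_bound[of UNIV])
    fix z
    show "((\<lambda>\<mu>. normal_density \<mu> s x) has_real_derivative normal_density z s x * ((x - z) / s / s)) (at z)"
      by (rule DERIV_normal_density_mean[OF s])
    have "norm (normal_density z s x * ((x - z) / s / s)) = normal_density z s x * \<bar>(x - z) / s\<bar> / s"
      using s by (simp add: abs_mult)
    also have "\<dots> \<le> 1 / s / s"
      using normal_density_bounds(2)[OF s, of z x] s by (intro divide_right_mono) auto
    also have "\<dots> \<le> 1 / c\<^sup>2"
      using c by (auto simp: power2_eq_square intro!: divide_left_mono mult_mono)
    finally show "norm (normal_density z s x * ((x - z) / s / s)) \<le> 1 / c\<^sup>2" .
  qed auto
  then show ?thesis by simp
qed

text \<open>The factor \<mu> is unbounded, but \<bar>\<mu>\<bar> \<le> K + s \<bar>u\<bar> with the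
  standardized residual \<open>u\<close>, and the density absorbs both \<bar>u\<bar> and its square.
  The bound on \<open>x\<close> enters through \<open>K\<close> in this splitting; the 3 collects 1
  from the density itself and 2 from the quadratic term.\<close>

lemma mean_normal_density_lipschitz:
  assumes c: "0 < c" "c \<le> s" and K: "\<bar>x\<bar> \<le> K"
  shows "\<bar>\<mu> * normal_density \<mu> s x - \<nu> * normal_density \<nu> s x\<bar> \<le> (3 / c + K / c\<^sup>2) * \<bar>\<mu> - \<nu>\<bar>"
proof -
  have s: "s > 0" using c by simp
  have "norm (\<mu> * normal_density \<mu> s x - \<nu> * normal_density \<nu> s x) \<le> (3 / c + K / c\<^sup>2) * norm (\<mu> - \<nu>)"
  proof (rule field_differentiable_bound[of UNIV])
    fix z
    let ?d = "normal_density z s x + z * (normal_density z s x * ((x - z) / s / s))"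
    show "((\<lambda>\<mu>. \<mu> * normal_density \<mu> s x) has_real_derivative ?d) (at z)"
      by (rule derivative_eq_intros DERIV_normal_density_mean[OF s] refl | simp)+
    define u where "u = (x - z) / s"
    have z: "\<bar>z\<bar> \<le> K + s * \<bar>u\<bar>"
      using K s by (auto simp: u_def)
    have n: "normal_density z s x \<ge> 0" by simp
    have "norm ?d \<le> normal_density z s x + \<bar>z\<bar> * (normal_density z s x * \<bar>u\<bar>) / s"
      using s abs_triangle_ineq[of "normal_density z s x" "z * (normal_density z s x * (u / s))"]
      by (simp add: u_def abs_mult)
    also have "\<dots> \<le> normal_density z s x + (K + s * \<bar>u\<bar>) * (normal_density z s x * \<bar>u\<bar>) / s"
      using z s n by (intro add_left_mono divide_right_mono mult_right_mono) auto
    also have "\<dots> = normal_density z s x + K * (normal_density z s x * \<bar>u\<bar>) / s + normal_density z s x * u\<^sup>2"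
      using s by (simp add: field_simps power2_eq_square flip: abs_mult)
    also have "\<dots> \<le> 1 / s + K * (1 / s) / s + 2 / s"
      using normal_density_bounds[OF s, of z x] K s unfolding u_def
      by (intro add_mono divide_right_mono mult_left_mono) auto
    also have "\<dots> = 3 / s + K / s\<^sup>2"
      by (simp add: power2_eq_square)
    also have "\<dots> \<le> 3 / c + K / c\<^sup>2"
      using c K by (intro add_mono divide_left_mono power_mono) auto
    finally show "norm ?d \<le> 3 / c + K / c\<^sup>2" .
  qed auto
  then show ?thesis by simp
qed

lemma integrable_lipschitz:
  fixes h :: "real \<Rightarrow> real"
  assumes G: "real_distribution G" "integrable G (\<lambda>x. x)"
    and h: "\<And>x y. \<bar>h x - h y\<bar> \<le> L * \<bar>x - y\<bar>" "h \<in> borel_measurable borel"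
  shows "integrable G h"
proof -
  interpret real_distribution G by fact
  show ?thesis
  proof (rule Bochner_Integration.integrable_bound)
    show "integrable G (\<lambda>x. \<bar>h 0\<bar> + L * \<bar>x\<bar>)"
      using G(2) by (intro Bochner_Integration.integrable_add integrable_mult_right integrable_abs) auto
    show "h \<in> borel_measurable G" using h(2) by simp
    have "norm (h x) \<le> norm (\<bar>h 0\<bar> + L * \<bar>x\<bar>)" for x
      using h(1)[of x 0] by auto
    then show "AE x in G. norm (h x) \<le> norm (\<bar>h 0\<bar> + L * \<bar>x\<bar>)" by simp
  qed
qed

text \<open>The product measure is a coupling; its second marginal reduces to the first by swapping
  the factors. Nonemptiness keeps the infimum in \<open>W1\<close> from being an infimum over the
  empty set, so lower bounds valid for every coupling pass to it.\<close>

lemma couplings_nonempty: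
  assumes "real_distribution G" "real_distribution G'"
  shows "couplings G G' \<noteq> {}"
proof -
  interpret G: real_distribution G by fact
  interpret G': real_distribution G' by fact
  interpret pair_prob_space G G' ..
  have "distr (G \<Otimes>\<^sub>M G') borel fst = distr (G \<Otimes>\<^sub>M G') G fst"
    by (rule distr_cong) auto
  also have "\<dots> = G" by (simp add: G'.distr_pair_fst)
  finally have 1: "distr (G \<Otimes>\<^sub>M G') borel fst = G" .
  have "distr (G \<Otimes>\<^sub>M G') borel snd = distr (G \<Otimes>\<^sub>M G') G' snd"
    by (rule distr_cong) auto
  also have "\<dots> = distr (distr (G' \<Otimes>\<^sub>M G) (G \<Otimes>\<^sub>M G') (\<lambda>(x, y). (y, x))) G' snd"
    by (subst pair_sigma_finite.distr_pair_swap) (simp_all add: pair_sigma_finite_axioms)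
  also have "\<dots> = distr (G' \<Otimes>\<^sub>M G) G' fst"
    by (subst distr_distr) (auto intro!: distr_cong)
  also have "\<dots> = G'" by (simp add: G.distr_pair_fst)
  finally have 2: "distr (G \<Otimes>\<^sub>M G') borel snd = G'" .
  have "sets (G \<Otimes>\<^sub>M G') = sets (borel \<Otimes>\<^sub>M borel)"
    by (rule sets_pair_measure_cong) auto
  with 1 2 have "G \<Otimes>\<^sub>M G' \<in> couplings G G'"
    by (simp add: couplings_def)
  then show ?thesis by blast
qed

lemma W1_nonneg:
  assumes "real_distribution G" "real_distribution G'"
  shows "0 \<le> W1 G G'"
  unfolding W1_def by (rule cINF_greatest[OF couplings_nonempty[OF assms]]) simp

text \<open>The easy half of Kantorovich duality.\<close>

lemma lipschitz_integral_W1: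
  fixes h :: "real \<Rightarrow> real"
  assumes G: "real_distribution G" "integrable G (\<lambda>x. x)"
    and G': "real_distribution G'" "integrable G' (\<lambda>x. x)"
    and h: "\<And>x y. \<bar>h x - h y\<bar> \<le> L * \<bar>x - y\<bar>" "h \<in> borel_measurable borel" and L: "L > 0"
  shows "\<bar>(LINT x|G. h x) - (LINT x|G'. h x)\<bar> \<le> L * W1 G G'"
proof -
  have "\<bar>(LINT x|G. h x) - (LINT x|G'. h x)\<bar> / L \<le> W1 G G'"
    unfolding W1_def
  proof (rule cINF_greatest)
    show "couplings G G' \<noteq> {}" by (rule couplings_nonempty[OF G(1) G'(1)])
    fix \<pi> assume "\<pi> \<in> couplings G G'"
    then have [measurable_cong]: "sets \<pi> = sets (borel \<Otimes>\<^sub>M borel)"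
      and 1: "distr \<pi> borel fst = G" and 2: "distr \<pi> borel snd = G'"
      by (auto simp: couplings_def)
    note [measurable] = h(2)
    have i1: "integrable \<pi> (\<lambda>z. g (fst z))" if "integrable G g" "g \<in> borel_measurable borel" for g :: "real \<Rightarrow> real"
      using that by (subst (asm) 1[symmetric], subst (asm) integrable_distr_eq) auto
    have i2: "integrable \<pi> (\<lambda>z. g (snd z))" if "integrable G' g" "g \<in> borel_measurable borel" for g :: "real \<Rightarrow> real"
      using that by (subst (asm) 2[symmetric], subst (asm) integrable_distr_eq) auto
    note int = i1[OF integrable_lipschitz[OF G h] h(2)] i2[OF integrable_lipschitz[OF G' h] h(2)]
    have "(LINT x|G. h x) = (LINT z|\<pi>. h (fst z))"
      by (subst 1[symmetric], subst integral_distr) auto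
    moreover have "(LINT x|G'. h x) = (LINT z|\<pi>. h (snd z))"
      by (subst 2[symmetric], subst integral_distr) auto
    ultimately have "(LINT x|G. h x) - (LINT x|G'. h x) = (LINT z|\<pi>. h (fst z) - h (snd z))"
      using int by simp
    also have "\<bar>\<dots>\<bar> \<le> (LINT z|\<pi>. \<bar>h (fst z) - h (snd z)\<bar>)"
      by (rule integral_abs_bound)
    also have "\<dots> \<le> (LINT z|\<pi>. L * \<bar>fst z - snd z\<bar>)"
    proof (rule integral_mono)
      show "integrable \<pi> (\<lambda>z. \<bar>h (fst z) - h (snd z)\<bar>)" using int by simp
      show "integrable \<pi> (\<lambda>z. L * \<bar>fst z - snd z\<bar>)"
        using i1[OF G(2)] i2[OF G'(2)] by simp
    qed (use h(1) in simp)
    also have "\<dots> = L * (LINT z|\<pi>. \<bar>fst z - snd z\<bar>)" by simp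
    finally show "\<bar>(LINT x|G. h x) - (LINT x|G'. h x)\<bar> / L \<le> (LINT z|\<pi>. \<bar>fst z - snd z\<bar>)"
      using L by (simp add: field_simps)
  qed
  then show ?thesis using L by (simp add: field_simps)
qed

subsection \<open>The posterior mean\<close>

lemma normal_density_lower:
  assumes c: "0 < c" "c \<le> s" "s \<le> C" and K: "\<bar>x\<bar> \<le> K" and R: "\<bar>\<mu>\<bar> \<le> R"
  shows "exp (- ((K + R) / c)\<^sup>2 / 2) / (C * sqrt (2 * pi)) \<le> normal_density \<mu> s x"
proof -
  have "\<bar>x - \<mu>\<bar> / s \<le> (K + R) / c"
    using c K R by (intro frac_le) auto
  then have "((x - \<mu>) / s)\<^sup>2 \<le> ((K + R) / c)\<^sup>2"
    using c K R by (subst abs_le_square_iff[symmetric]) auto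
  then have "exp (- ((K + R) / c)\<^sup>2 / 2) / (C * sqrt (2 * pi)) \<le> exp (- ((x - \<mu>) / s)\<^sup>2 / 2) / (s * sqrt (2 * pi))"
    using c by (intro frac_le) auto
  then show ?thesis using c by (simp add: normal_density_exp)
qed

text \<open>Moving the observation from \<open>x\<close> to \<open>y\<close> tilts the likelihood
  exponentially in \<mu>, since the quadratic terms in \<mu> cancel. For x \<le> y the tilt is
  increasing in \<mu>, which is the source of both the monotonicity and the slope of the posterior
  mean.\<close>

lemma normal_density_tilt:
  assumes "s > 0"
  shows "normal_density \<mu> s y = normal_density \<mu> s x * exp ((y - x) * (2 * \<mu> - x - y) / (2 * s\<^sup>2))"
proof -
  have "- ((y - \<mu>) / s)\<^sup>2 / 2 = - ((x - \<mu>) / s)\<^sup>2 / 2 + (y - x) * (2 * \<mu> - x - y) / (2 * s\<^sup>2)"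
    using assms by (simp add: field_simps power2_eq_square)
  then show ?thesis
    using assms by (simp only: normal_density_exp exp_add mult.assoc)
qed

text \<open>The slope of exp is at least \<open>exp e\<close> to the right of \<open>e\<close>. In
  this product form the bound needs no case distinction on the order of \<open>u\<close> and
  \<open>v\<close> when it is integrated.\<close>

lemma exp_diff_mult_ge:
  fixes u v :: real
  assumes "e \<le> u" "e \<le> v"
  shows "exp e * (u - v)\<^sup>2 \<le> (u - v) * (exp u - exp v)"
proof -
  have *: "exp e * (u - v) \<le> exp u - exp v" if "e \<le> v" "v \<le> u" for u v :: real
  proof -
    have "exp e * (u - v) \<le> exp v * (u - v)"
      using that by (intro mult_right_mono) auto
    also have "\<dots> \<le> exp v * (exp (u - v) - 1)"
      using exp_ge_add_one_self[of "u - v"] by (intro mult_left_mono) (linarith, simp)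
    also have "\<dots> = exp u - exp v" by (simp add: exp_diff field_simps)
    finally show ?thesis .
  qed
  show ?thesis
  proof (cases "v \<le> u")
    case True
    from mult_left_mono[OF *[OF assms(2) True], of "u - v"] True show ?thesis
      by (simp add: power2_eq_square mult_ac)
  next
    case False
    then have "u \<le> v" by simp
    from mult_left_mono[OF *[OF assms(1) this], of "v - u"] this show ?thesis
      by (simp add: power2_eq_square algebra_simps)
  qed
qed

lemma (in prob_space) prob_UN_pos:
  fixes A :: "nat \<Rightarrow> 'a set"
  assumes "range A \<subseteq> events" "prob (\<Union>i. A i) > 0"
  shows "\<exists>i. prob (A i) > 0"
proof (rule ccontr)
  assume "\<not> ?thesis"
  then have "prob (A i) = 0" for i
    using measure_nonneg[of M "A i"] by (metis less_eq_real_def)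
  then have "A i \<in> null_sets M" for i
    using assms(1) by (auto simp: emeasure_eq_measure)
  then have "(\<Union>i. A i) \<in> null_sets M" by (intro null_sets_UN) auto
  with assms(2) show False by (auto simp: emeasure_eq_measure)
qed

lemma measurable_normal_density_mean [measurable]:
  "(\<lambda>\<mu>. normal_density \<mu> s x) \<in> borel_measurable borel"
  unfolding normal_density_def by measurable

text \<open>Half-lines starting at a + 1 / (i + 1) exhaust the open half-line at \<open>a\<close>.
  The strict gap obtained here later separates two parts of the prior and leaves room between a
  threshold and the end of the support.\<close>

lemma (in real_distribution) prob_greaterThan_pos:
  assumes "prob {a<..} > 0"
  shows "\<exists>b>a. prob {b<..} > 0"
proof -
  have "{a<..} = (\<Union>i::nat. {a + 1 / real (Suc i)<..})"
  proof -
    have "\<exists>i::nat. a + 1 / real (Suc i) < x" if "a < x" for x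
    proof -
      have "0 < x - a" using that by simp
      then obtain i where "inverse (real (Suc i)) < x - a" using reals_Archimedean by blast
      then show ?thesis by (intro exI[of _ i]) (simp add: inverse_eq_divide)
    qed
    moreover have "a < x" if "a + 1 / real (Suc i) < x" for x i
    proof -
      have "0 < 1 / real (Suc i)" by simp
      then show ?thesis using that by linarith
    qed
    ultimately show ?thesis by auto
  qed
  then have "\<exists>i::nat. prob {a + 1 / real (Suc i)<..} > 0"
    using assms by (intro prob_UN_pos) (simp_all only:, auto)
  then obtain i :: nat where "prob {a + 1 / real (Suc i)<..} > 0" by blast
  then show ?thesis by (intro exI[of _ "a + 1 / real (Suc i)"]) simp
qed

section \<open>Posterior means under a prior with finite first moment\<close>

locale moment_distribution = real_distribution G for G :: "real measure" +
  assumes first_moment: "integrable G (\<lambda>\<mu>. \<mu>)"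
begin

definition marginal :: "real \<Rightarrow> real \<Rightarrow> real"
  where "marginal s x = (LINT \<mu>|G. normal_density \<mu> s x)"

text \<open>Passing to a bounded part of a set keeps its mass positive, and for bounded \<mu> the
  Gaussian density is bounded below uniformly over bounded \<open>x\<close> and a compact range of
  scales.\<close>

lemma prob_bounded_part_pos:
  assumes "A \<in> sets borel" "prob A > 0"
  shows "\<exists>R\<ge>0. prob (A \<inter> {-R..R}) > 0"
proof -
  have "(\<Union>i::nat. A \<inter> {- real i..real i}) = A"
  proof -
    have "\<exists>i::nat. - real i \<le> x \<and> x \<le> real i" for x
      using real_arch_simple[of "\<bar>x\<bar>"] by (auto simp: abs_le_iff) (metis minus_le_iff)
    then show ?thesis by auto
  qed
  then have "\<exists>i::nat. prob (A \<inter> {- real i..real i}) > 0"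
    using assms by (intro prob_UN_pos) auto
  then show ?thesis using of_nat_0_le_iff by blast
qed

lemma integrable_normal_density:
  assumes "s > 0"
  shows "integrable G (\<lambda>\<mu>. normal_density \<mu> s x)"
  using normal_density_bounds(1)[OF assms]
  by (intro integrable_const_bound[of _ "1 / s"]) (auto simp: normal_density_def)

lemma integrable_mean_normal_density:
  assumes "s > 0"
  shows "integrable G (\<lambda>\<mu>. (\<mu> - t) * normal_density \<mu> s x)"
proof -
  have "integrable G (\<lambda>\<mu>. \<mu> * normal_density \<mu> s x)"
    using real_distribution_axioms first_moment mean_normal_density_lipschitz[OF assms order.refl order.refl]
    by (rule integrable_lipschitz) auto
  then show ?thesis
    using integrable_normal_density[OF assms] by (auto simp: left_diff_distrib)
qed

lemma marginal_lower:
  assumes c: "0 < c" "c \<le> s" "s \<le> C" and K: "\<bar>x\<bar> \<le> K"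
  shows "prob {-R..R} * (exp (- ((K + R) / c)\<^sup>2 / 2) / (C * sqrt (2 * pi))) \<le> marginal s x"
proof -
  let ?d = "exp (- ((K + R) / c)\<^sup>2 / 2) / (C * sqrt (2 * pi))"
  have "(LINT \<mu>|G. ?d * indicator {-R..R} \<mu>) \<le> marginal s x"
    unfolding marginal_def
  proof (rule integral_mono)
    fix \<mu>
    show "?d * indicator {-R..R} \<mu> \<le> normal_density \<mu> s x"
      using normal_density_lower[OF c K, of \<mu> R] by (auto split: split_indicator simp: abs_le_iff)
    show "integrable G (\<lambda>\<mu>. ?d * indicator {-R..R} \<mu>)"
      by (intro integrable_mult_right integrable_real_indicator) (auto simp: emeasure_eq_measure)
  qed (use c in \<open>simp add: integrable_normal_density\<close>)
  then show ?thesis by (simp add: mult.commute)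
qed

lemma marginal_bounded_below:
  assumes c: "0 < c" "c \<le> C"
  shows "\<exists>d>0. \<forall>s x. c \<le> s \<longrightarrow> s \<le> C \<longrightarrow> \<bar>x\<bar> \<le> K \<longrightarrow> d \<le> marginal s x"
proof -
  have "prob UNIV > 0" using prob_space by simp
  then obtain R where R: "prob {-R..R} > 0"
    using prob_bounded_part_pos[of UNIV] by auto
  then show ?thesis
    using marginal_lower[of c _ C _ K R] c
    by (intro exI[of _ "prob {-R..R} * (exp (- ((K + R) / c)\<^sup>2 / 2) / (C * sqrt (2 * pi)))"]) auto
qed

lemma marginal_pos: "s > 0 \<Longrightarrow> marginal s x > 0"
  using marginal_bounded_below[of s s "\<bar>x\<bar>"] by force

lemma marginal_upper:
  assumes "s > 0" shows "marginal s x \<le> 1 / s"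
proof -
  have "marginal s x \<le> (LINT \<mu>|G. 1 / s)"
    unfolding marginal_def
    using normal_density_bounds(1)[OF assms] assms by (intro integral_mono integrable_normal_density) auto
  then show ?thesis using prob_space by simp
qed

text \<open>As the marginal is positive, the sign of the left-hand side decides whether the
  posterior mean lies above or below the level \<open>t\<close>; at the posterior mean itself the
  integral vanishes. Comparisons with a level thus need no quotients.\<close>

lemma integral_centered:
  assumes s: "s > 0"
  shows "(LINT \<mu>|G. (\<mu> - t) * normal_density \<mu> s x) = (posterior_mean G s x - t) * marginal s x"
proof -
  have "(LINT \<mu>|G. (\<mu> - t) * normal_density \<mu> s x) =
      (LINT \<mu>|G. \<mu> * normal_density \<mu> s x) - t * marginal s x"
    using integrable_mean_normal_density[OF s, of 0 x] integrable_normal_density[OF s, of x]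
    by (simp add: left_diff_distrib marginal_def)
  also have "(LINT \<mu>|G. \<mu> * normal_density \<mu> s x) = posterior_mean G s x * marginal s x"
    using marginal_pos[OF s, of x] by (simp add: posterior_mean_normal_density[OF s] marginal_def)
  finally show ?thesis by (simp add: left_diff_distrib)
qed

lemma posterior_mean_bounded:
  assumes c: "0 < c" "c \<le> C"
  shows "\<exists>B>0. \<forall>s x. c \<le> s \<longrightarrow> s \<le> C \<longrightarrow> \<bar>x\<bar> \<le> K \<longrightarrow> \<bar>posterior_mean G s x\<bar> \<le> B"
proof -
  from marginal_bounded_below[OF c] obtain d where d: "d > 0"
    "\<And>s x. c \<le> s \<Longrightarrow> s \<le> C \<Longrightarrow> \<bar>x\<bar> \<le> K \<Longrightarrow> d \<le> marginal s x" by metis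
  define m where "m = (LINT \<mu>|G. \<bar>\<mu>\<bar>)"
  have m: "m \<ge> 0" by (simp add: m_def)
  \<comment> \<open>The summand 1 only makes the bound strictly positive: \<open>m\<close> is 0 for
    the point mass at 0.\<close>
  have "\<bar>posterior_mean G s x\<bar> \<le> m / c / d + 1" if s: "c \<le> s" "s \<le> C" "\<bar>x\<bar> \<le> K" for s x
  proof -
    have s0: "s > 0" using s c by simp
    have "\<bar>posterior_mean G s x\<bar> * marginal s x = \<bar>posterior_mean G s x * marginal s x\<bar>"
      using marginal_pos[OF s0, of x] by (simp add: abs_mult)
    also have "\<dots> = \<bar>LINT \<mu>|G. \<mu> * normal_density \<mu> s x\<bar>"
      using integral_centered[OF s0, of 0 x] by simp
    also have "\<dots> \<le> (LINT \<mu>|G. \<bar>\<mu> * normal_density \<mu> s x\<bar>)" by (rule integral_abs_bound)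
    also have "\<dots> \<le> (LINT \<mu>|G. \<bar>\<mu>\<bar> * (1 / c))"
    proof (rule integral_mono)
      show "integrable G (\<lambda>\<mu>. \<bar>\<mu> * normal_density \<mu> s x\<bar>)"
        using integrable_mean_normal_density[OF s0, of 0 x] by simp
      fix \<mu>
      have "normal_density \<mu> s x \<le> 1 / c"
        using normal_density_bounds(1)[OF s0, of \<mu> x] s c by (smt (verit) frac_le)
      then show "\<bar>\<mu> * normal_density \<mu> s x\<bar> \<le> \<bar>\<mu>\<bar> * (1 / c)"
        by (simp only: abs_mult) (intro mult_left_mono, auto)
    qed (use first_moment in auto)
    also have "\<dots> = m / c" by (simp add: m_def)
    finally have "\<bar>posterior_mean G s x\<bar> * marginal s x \<le> m / c" .
    moreover have "\<bar>posterior_mean G s x\<bar> * d \<le> \<bar>posterior_mean G s x\<bar> * marginal s x"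
      using d(2)[OF s] by (intro mult_left_mono) auto
    ultimately have "\<bar>posterior_mean G s x\<bar> * d \<le> m / c" by linarith
    then have "\<bar>posterior_mean G s x\<bar> \<le> m / c / d"
      using d(1) by (simp only: pos_le_divide_eq)
    then show ?thesis by simp
  qed
  then show ?thesis using m c d(1) by (intro exI[of _ "m / c / d + 1"]) (auto intro: add_nonneg_pos)
qed

text \<open>Centering at the posterior mean at \<open>x\<close> makes the increment a single integral with nonnegative integrand.\<close>

lemma posterior_mean_increment:
  fixes s x y :: real
  assumes s: "s > 0"
  defines "f \<equiv> posterior_mean G s x"
    and "E \<equiv> \<lambda>\<mu>. exp ((y - x) * (2 * \<mu> - x - y) / (2 * s\<^sup>2))"
  shows "integrable G (\<lambda>\<mu>. (\<mu> - f) * (E \<mu> - E f) * normal_density \<mu> s x)"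
    and "(posterior_mean G s y - f) * marginal s y =
      (LINT \<mu>|G. (\<mu> - f) * (E \<mu> - E f) * normal_density \<mu> s x)"
proof -
  \<comment> \<open>The second term integrates to 0 because \<open>f\<close> is the posterior mean
    at \<open>x\<close>; the first is the centered integral at \<open>y\<close>, by the
    tilt.\<close>
  have eq: "(\<lambda>\<mu>. (\<mu> - f) * (E \<mu> - E f) * normal_density \<mu> s x) =
     (\<lambda>\<mu>. (\<mu> - f) * normal_density \<mu> s y - E f * ((\<mu> - f) * normal_density \<mu> s x))"
    by (simp add: fun_eq_iff normal_density_tilt[OF s, of _ y x] E_def algebra_simps)
  note int = integrable_mean_normal_density[OF s, of f]
  show "integrable G (\<lambda>\<mu>. (\<mu> - f) * (E \<mu> - E f) * normal_density \<mu> s x)"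
    unfolding eq using int by auto
  show "(posterior_mean G s y - f) * marginal s y =
      (LINT \<mu>|G. (\<mu> - f) * (E \<mu> - E f) * normal_density \<mu> s x)"
    unfolding eq using int integral_centered[OF s, of f] by (simp add: f_def)
qed

text \<open>Both factors of the centered integrand change sign at the posterior mean, so their
  product is nonnegative. No bound on \<open>x\<close> or \<open>y\<close> is involved, so for an
  estimated prior this extends information at a cutoff to the entire tail.\<close>

lemma posterior_mean_mono:
  assumes s: "s > 0" and xy: "x \<le> y"
  shows "posterior_mean G s x \<le> posterior_mean G s y"
proof -
  let ?f = "posterior_mean G s x"
  have "0 \<le> (\<mu> - ?f) * (exp ((y - x) * (2 * \<mu> - x - y) / (2 * s\<^sup>2)) -
      exp ((y - x) * (2 * ?f - x - y) / (2 * s\<^sup>2)))" for \<mu>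
  proof (cases "?f \<le> \<mu>")
    case True
    then show ?thesis using s xy
      by (intro mult_nonneg_nonneg) (auto intro!: divide_right_mono mult_left_mono)
  next
    case False
    then show ?thesis using s xy
      by (intro mult_nonpos_nonpos) (auto intro!: divide_right_mono mult_left_mono)
  qed
  then have "0 \<le> (posterior_mean G s y - ?f) * marginal s y"
    unfolding posterior_mean_increment(2)[OF s] by (intro Bochner_Integration.integral_nonneg) auto
  then show ?thesis
    using marginal_pos[OF s, of y] by (simp add: zero_le_mult_iff)
qed

text \<open>Up to a positive factor \<open>q\<close>, the likelihood is exp (x (\<mu> - t) / s^2)
  times a Gaussian weight at most 1. For x \<ge> 0, means below \<open>t\<close> then get weight at
  most 1 and pull down by at most the first absolute moment about \<open>t\<close>, while the mass
  beyond \<open>b\<close> gets a weight that grows exponentially in \<open>x\<close>. The range of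
  scales makes this growth uniform in \<open>s\<close>.\<close>

lemma posterior_mean_exceeds:
  assumes c: "0 < c" and t: "t < b" and b: "prob {b<..} > 0"
  shows "\<exists>K\<ge>0. \<forall>s x. c \<le> s \<longrightarrow> s \<le> C \<longrightarrow> K \<le> x \<longrightarrow> t \<le> posterior_mean G s x"
proof -
  from prob_bounded_part_pos[OF _ b] obtain R where R: "R \<ge> 0" "prob ({b<..} \<inter> {-R..R}) > 0" by auto
  define S where "S = {b<..} \<inter> {-R..R}"
  define m where "m = (LINT \<mu>|G. \<bar>\<mu> - t\<bar>)"
  define p where "p = (b - t) * prob S * exp (- R\<^sup>2 / (2 * c\<^sup>2))"
  have p: "p > 0" using R t by (simp add: p_def S_def)
  \<comment> \<open>Solves 1 + K (b - t) / C^2 \<ge> m / p, a sufficient condition for the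
    exponential weight to reach \<open>m / p\<close> because exp y \<ge> 1 + y. The maximum with 0
    guarantees x \<ge> 0, on which the bound for means below \<open>t\<close> relies.\<close>
  define K where "K = max 0 (C\<^sup>2 / (b - t) * (m / p))"
  have m0: "m \<ge> 0" by (simp add: m_def)
  have "t \<le> posterior_mean G s x" if s: "c \<le> s" "s \<le> C" and x: "K \<le> x" for s x
  proof -
    have s0: "s > 0" using s c by simp
    have x0: "x \<ge> 0" using x by (simp add: K_def)
    define q where "q = 1 / (s * sqrt (2 * pi)) * exp (- x\<^sup>2 / (2 * s\<^sup>2) + x * t / s\<^sup>2)"
    have q: "q > 0" using s0 by (simp add: q_def)
    have dens: "normal_density \<mu> s x = q * (exp (x * (\<mu> - t) / s\<^sup>2) * exp (- \<mu>\<^sup>2 / (2 * s\<^sup>2)))" for \<mu>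
    proof -
      have "- ((x - \<mu>) / s)\<^sup>2 / 2 = (- x\<^sup>2 / (2 * s\<^sup>2) + x * t / s\<^sup>2) + (x * (\<mu> - t) / s\<^sup>2 + - \<mu>\<^sup>2 / (2 * s\<^sup>2))"
        using s0 by (simp add: field_simps power2_eq_square)
      then show ?thesis unfolding normal_density_exp[OF s0] q_def by (simp only: exp_add mult.assoc)
    qed
    define e where "e = (b - t) * exp (x * (b - t) / C\<^sup>2) * exp (- R\<^sup>2 / (2 * c\<^sup>2))"
    have pw: "q * (e * indicator S \<mu> - \<bar>\<mu> - t\<bar>) \<le> (\<mu> - t) * normal_density \<mu> s x" for \<mu>
    proof -
      have "e * indicator S \<mu> - \<bar>\<mu> - t\<bar> \<le> (\<mu> - t) * (exp (x * (\<mu> - t) / s\<^sup>2) * exp (- \<mu>\<^sup>2 / (2 * s\<^sup>2)))"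
      proof (cases "\<mu> \<ge> t")
        case True
        show ?thesis
        proof (cases "\<mu> \<in> S")
          case True
          then have \<mu>: "b < \<mu>" "\<bar>\<mu>\<bar> \<le> R" by (auto simp: S_def)
          have "\<mu>\<^sup>2 \<le> R\<^sup>2" using \<mu> R(1) by (simp add: abs_le_square_iff[symmetric])
          have "\<mu>\<^sup>2 / (2 * s\<^sup>2) \<le> R\<^sup>2 / (2 * c\<^sup>2)"
            using s c by (intro frac_le mult_left_mono \<open>\<mu>\<^sup>2 \<le> R\<^sup>2\<close> power_mono) auto
          moreover have "x * (b - t) / C\<^sup>2 \<le> x * (\<mu> - t) / s\<^sup>2"
            using s c \<mu> t x0 s0 by (intro frac_le mult_left_mono power_mono) auto
          ultimately have "e \<le> (\<mu> - t) * (exp (x * (\<mu> - t) / s\<^sup>2) * exp (- \<mu>\<^sup>2 / (2 * s\<^sup>2)))"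
            unfolding e_def mult.assoc using \<mu> t by (intro mult_mono) auto
          then show ?thesis using True by simp
        qed (use True in \<open>auto intro: order.trans[of _ 0]\<close>)
      next
        case False
        have "exp (x * (\<mu> - t) / s\<^sup>2) * exp (- \<mu>\<^sup>2 / (2 * s\<^sup>2)) \<le> 1 * 1"
          using False x0 by (intro mult_mono) (auto intro!: divide_nonpos_nonneg mult_nonneg_nonpos)
        then have "(\<mu> - t) * 1 \<le> (\<mu> - t) * (exp (x * (\<mu> - t) / s\<^sup>2) * exp (- \<mu>\<^sup>2 / (2 * s\<^sup>2)))"
          using False by (intro mult_left_mono_neg) auto
        moreover have "\<mu> \<notin> S" using False t by (auto simp: S_def)
        ultimately show ?thesis using False by simp
      qed
      from mult_left_mono[OF this, of q] q show ?thesis unfolding dens by (simp add: mult_ac)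
    qed
    have "K * (b - t) / C\<^sup>2 \<le> x * (b - t) / C\<^sup>2"
      using x t by (intro divide_right_mono mult_right_mono) auto
    moreover have "m / p \<le> K * (b - t) / C\<^sup>2"
    proof -
      have "C\<^sup>2 / (b - t) * (m / p) \<le> K" by (simp add: K_def)
      then have "C\<^sup>2 / (b - t) * (m / p) * (b - t) / C\<^sup>2 \<le> K * (b - t) / C\<^sup>2"
        using t by (intro divide_right_mono mult_right_mono) auto
      then show ?thesis using t c s by simp
    qed
    ultimately have "m / p \<le> exp (x * (b - t) / C\<^sup>2)"
      using exp_ge_add_one_self[of "x * (b - t) / C\<^sup>2"] by linarith
    then have "m \<le> e * prob S"
      using p by (simp add: p_def e_def field_simps)
    have int: "integrable G (\<lambda>\<mu>. e * indicator S \<mu>)" "integrable G (\<lambda>\<mu>. \<bar>\<mu> - t\<bar>)"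
      by (intro integrable_mult_right integrable_real_indicator integrable_abs
          Bochner_Integration.integrable_diff first_moment; auto simp: S_def emeasure_eq_measure)+
    from \<open>m \<le> e * prob S\<close> have "0 \<le> q * (e * prob S - m)" using q by simp
    also have "\<dots> = (LINT \<mu>|G. q * (e * indicator S \<mu> - \<bar>\<mu> - t\<bar>))"
      using int by (simp add: m_def S_def)
    also have "\<dots> \<le> (LINT \<mu>|G. (\<mu> - t) * normal_density \<mu> s x)"
      by (intro integral_mono integrable_mean_normal_density[OF s0] pw integrable_mult_right
          Bochner_Integration.integrable_diff int)
    also have "\<dots> = (posterior_mean G s x - t) * marginal s x"
      by (rule integral_centered[OF s0])
    finally show ?thesis
      using marginal_pos[OF s0, of x] by (simp add: zero_le_mult_iff)
  qed
  then show ?thesis by (intro exI[of _ K]) (auto simp: K_def)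
qed

section \<open>Reflection of the prior, and its mass beyond the posterior mean\<close>

lemma reflection: "moment_distribution (distr G borel uminus)"
proof -
  have "integrable (distr G borel uminus) (\<lambda>\<mu>. \<mu>)"
  proof (rule integrable_distr_eq[THEN iffD2])
    show "uminus \<in> G \<rightarrow>\<^sub>M borel" by measurable
    show "(\<lambda>\<mu>. \<mu>) \<in> borel_measurable (borel :: real measure)" by (rule measurable_ident_sets) (rule refl)
    show "integrable G (\<lambda>\<mu>. - \<mu>)" by (rule Bochner_Integration.integrable_minus[OF first_moment])
  qed
  then show ?thesis
  proof (intro moment_distribution.intro moment_distribution_axioms.intro)
    show "real_distribution (distr G borel uminus)"
      by (rule real_distribution_distr) measurable
  qed
qed

text \<open>The likelihood is invariant under changing the signs of both \<mu> and \<open>x\<close>.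
  Each statement about the upper end of the support therefore yields the one about the lower
  end.\<close>

lemma posterior_mean_reflection:
  assumes s: "s > 0"
  shows "posterior_mean (distr G borel uminus) s x = - posterior_mean G s (- x)"
proof -
  have "normal_density (- \<mu>) s x = normal_density \<mu> s (- x)" for \<mu>
    by (simp add: normal_density_def power2_eq_square algebra_simps)
  then show ?thesis
    by (simp add: posterior_mean_normal_density[OF s] integral_distr)
qed

text \<open>Without mass above the posterior mean, the centered integrand would have constant sign
  and integral 0, hence vanish almost surely. The density is positive, so \<mu> would equal the
  posterior mean almost surely and the prior would be a point mass.\<close>

lemma prob_greater_posterior_mean:
  assumes nd: "\<And>a. G \<noteq> return borel a" and s: "s > 0"
  shows "prob {posterior_mean G s x<..} > 0"
proof (rule ccontr)
  let ?f = "posterior_mean G s x"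
  assume "\<not> ?thesis"
  then have "prob {?f<..} = 0" using measure_nonneg[of G "{?f<..}"] by linarith
  then have ae: "AE \<mu> in G. \<mu> \<le> ?f"
    by (intro AE_I[of _ _ "{?f<..}"]) (auto simp: emeasure_eq_measure)
  have "AE \<mu> in G. (\<mu> - ?f) * normal_density \<mu> s x = 0"
  proof -
    have "(LINT \<mu>|G. - ((\<mu> - ?f) * normal_density \<mu> s x)) = 0"
      using integral_centered[OF s, of ?f x] by simp
    moreover have "integrable G (\<lambda>\<mu>. - ((\<mu> - ?f) * normal_density \<mu> s x))"
      using integrable_mean_normal_density[OF s] by simp
    moreover have "AE \<mu> in G. 0 \<le> - ((\<mu> - ?f) * normal_density \<mu> s x)"
      using ae by eventually_elim (simp add: mult_nonpos_nonneg)
    ultimately have "AE \<mu> in G. - ((\<mu> - ?f) * normal_density \<mu> s x) = 0"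
      using integral_nonneg_eq_0_iff_AE by blast
    then show ?thesis by simp
  qed
  then have "AE \<mu> in G. \<mu> = ?f"
  proof eventually_elim
    case (elim \<mu>)
    then show ?case using normal_density_pos[OF s, of \<mu> x] by simp
  qed
  then have "distr G borel (\<lambda>\<mu>. \<mu>) = distr G borel (\<lambda>_. ?f)"
    by (intro distr_cong_AE) auto
  moreover have "distr G borel (\<lambda>\<mu>. \<mu>) = G" by (rule distr_id2) simp
  moreover have "distr G borel (\<lambda>_. ?f) = return borel ?f"
    by (rule distr_const) simp
  ultimately show False using nd by metis
qed

end

section \<open>Nondegenerate priors: slope of the posterior mean and its stability in the
  prior\<close>

locale prior = moment_distribution +
  assumes nondegenerate: "G \<noteq> return borel a"
begin

lemma prior_reflection: "prior (distr G borel uminus)"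
proof -
  interpret R: moment_distribution "distr G borel uminus" by (rule reflection)
  show ?thesis
  proof
    fix a show "distr G borel uminus \<noteq> return borel a"
    proof
      assume *: "distr G borel uminus = return borel a"
      have "G = distr G borel (uminus \<circ> uminus)" by (simp add: comp_def distr_id2)
      also have "\<dots> = distr (distr G borel uminus) borel uminus" by (subst distr_distr) auto
      also have "\<dots> = return borel (- a)" unfolding * by (subst distr_return) auto
      finally show False using nondegenerate by simp
    qed
  qed
qed

text \<open>Nondegeneracy in quantitative form: whatever center is chosen, one of the two half-lines
  stays at distance at least (b - a) / 2 from it.\<close>

lemma prob_both_sides:
  obtains a b where "a < b" "prob {..a} > 0" "prob {b..} > 0"
proof -
  \<comment> \<open>Any posterior mean has prior mass strictly on both sides; scale 1 and
    observation 0 are an arbitrary choice.\<close>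
  define a where "a = posterior_mean G 1 0"
  interpret R: prior "distr G borel uminus" by (rule prior_reflection)
  have "prob {a<..} > 0"
    unfolding a_def by (rule prob_greater_posterior_mean[OF nondegenerate]) simp
  then obtain b where b: "a < b" "prob {b<..} > 0" using prob_greaterThan_pos by blast
  note b(2)
  also have "prob {b<..} \<le> prob {b..}" by (intro finite_measure_mono) auto
  finally have b': "prob {b..} > 0" .
  have "0 < R.prob {posterior_mean (distr G borel uminus) 1 0<..}"
    by (rule R.prob_greater_posterior_mean[OF R.nondegenerate]) simp
  also have "\<dots> = prob {..<a}"
    by (subst measure_distr) (auto simp: posterior_mean_reflection a_def vimage_def intro!: arg_cong[of _ _ prob])
  also have "\<dots> \<le> prob {..a}" by (intro finite_measure_mono) auto
  finally show ?thesis using b(1) b' by (intro that[of a b]) auto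
qed

text \<open>For bounded \<mu> the integrand of the increment is at least a constant times (y - x)
  (\<mu> - f)^2, by the lower bound on the slope of exp. Integrating over a set that carries prior
  mass and stays away from \<open>f\<close> leaves a multiple of \<open>y - x\<close>; elsewhere the
  integrand is nonnegative and is dropped.\<close>

lemma posterior_mean_strict:
  assumes c: "0 < c" "c \<le> C" and K: "0 \<le> K"
  shows "\<exists>\<kappa>>0. \<forall>s x y. c \<le> s \<longrightarrow> s \<le> C \<longrightarrow> - K \<le> x \<longrightarrow> x \<le> y \<longrightarrow> y \<le> K \<longrightarrow>
    \<kappa> * (y - x) \<le> posterior_mean G s y - posterior_mean G s x"
proof -
  obtain a b where ab: "a < b" "prob {..a} > 0" "prob {b..} > 0" by (rule prob_both_sides)
  obtain R1 where R1: "R1 \<ge> 0" "prob ({..a} \<inter> {-R1..R1}) > 0" using prob_bounded_part_pos[OF _ ab(2)] by auto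
  obtain R2 where R2: "R2 \<ge> 0" "prob ({b..} \<inter> {-R2..R2}) > 0" using prob_bounded_part_pos[OF _ ab(3)] by auto
  obtain B where B: "B > 0" "\<And>s x. c \<le> s \<Longrightarrow> s \<le> C \<Longrightarrow> \<bar>x\<bar> \<le> K \<Longrightarrow> \<bar>posterior_mean G s x\<bar> \<le> B"
    using posterior_mean_bounded[OF c, of K] by metis
  \<comment> \<open>Including \<open>B\<close> puts the posterior mean \<open>f\<close> itself
    within [-R, R], where the exponent bound is applied to it as well as to \<mu>.\<close>
  define R where "R = max (max R1 R2) B"
  define p where "p = min (prob ({..a} \<inter> {-R1..R1})) (prob ({b..} \<inter> {-R2..R2}))"
  have p: "p > 0" using R1 R2 by (simp add: p_def)
  \<comment> \<open>A lower bound for the exponent of the tilt: \<open>y - x\<close> is at most 2 K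
    and 2 \<mu> - x - y is at most 2 R + 2 K in absolute value.\<close>
  define e where "e = - (2 * K * (2 * R + 2 * K) / (2 * c\<^sup>2))"
  define d where "d = exp (- ((K + R) / c)\<^sup>2 / 2) / (C * sqrt (2 * pi))"
  have d: "d > 0" using c by (simp add: d_def)
  \<comment> \<open>The factors are, in order: \<open>c\<close> from the marginal at
    \<open>y\<close> being at most 1 / c, the slope of the tilt, the squared distance from
    \<open>f\<close>, the lower bound of the density, and the prior mass of the set that is
    kept.\<close>
  define \<kappa> where "\<kappa> = c * (exp e / C\<^sup>2 * ((b - a) / 2)\<^sup>2 * d * p)"
  have \<kappa>: "\<kappa> > 0" using c d p ab by (simp add: \<kappa>_def)
  have "\<kappa> * (y - x) \<le> posterior_mean G s y - posterior_mean G s x"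
    if s: "c \<le> s" "s \<le> C" and xy: "- K \<le> x" "x \<le> y" "y \<le> K" for s x y
  proof -
    have s0: "s > 0" using s c by simp
    define f where "f = posterior_mean G s x"
    have "\<bar>x\<bar> \<le> K" using xy by (simp add: abs_le_iff)
    from B(2)[OF s this] have fR: "\<bar>f\<bar> \<le> R" by (simp add: f_def R_def)
    define T where "T \<mu> = (y - x) * (2 * \<mu> - x - y) / (2 * s\<^sup>2)" for \<mu>
    have Te: "e \<le> T \<mu>" if "\<bar>\<mu>\<bar> \<le> R" for \<mu>
    proof -
      have "\<bar>T \<mu>\<bar> \<le> 2 * K * (2 * R + 2 * K) / (2 * c\<^sup>2)"
        unfolding T_def abs_divide abs_mult using xy that s c K
        by (intro frac_le mult_mono) (auto intro!: power_mono)
      then show ?thesis unfolding e_def by linarith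
    qed
    have TT: "T \<mu> - T f = (y - x) / s\<^sup>2 * (\<mu> - f)" for \<mu>
      using s0 by (simp add: T_def field_simps)
    \<comment> \<open>The case \<open>x = y\<close> is split off because the sign is found after
      multiplication by the factor (y - x) / s^2, which has to be positive.\<close>
    have pw0: "0 \<le> (\<mu> - f) * (exp (T \<mu>) - exp (T f))" for \<mu>
    proof (cases "x = y")
      case False
      then have h: "(y - x) / s\<^sup>2 > 0" using xy s0 by simp
      have "0 \<le> (T \<mu> - T f) * (exp (T \<mu>) - exp (T f))"
        using exp_diff_mult_ge[of "min (T \<mu>) (T f)" "T \<mu>" "T f"]
        by (smt (verit) exp_ge_zero mult_nonneg_nonneg zero_le_power2)
      then show ?thesis using h unfolding TT mult.assoc by (simp only: zero_le_mult_iff) auto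
    qed (simp add: T_def)
    have pw1: "exp e * (y - x) / C\<^sup>2 * (\<mu> - f)\<^sup>2 * d \<le> (\<mu> - f) * (exp (T \<mu>) - exp (T f)) * normal_density \<mu> s x"
      if \<mu>: "\<bar>\<mu>\<bar> \<le> R" for \<mu>
    proof (rule mult_mono)
      show "exp e * (y - x) / C\<^sup>2 * (\<mu> - f)\<^sup>2 \<le> (\<mu> - f) * (exp (T \<mu>) - exp (T f))"
      proof (cases "x = y")
        case False
        then have h: "(y - x) / s\<^sup>2 > 0" using xy s0 by simp
        have "exp e * ((y - x) / s\<^sup>2 * (\<mu> - f))\<^sup>2 \<le> (y - x) / s\<^sup>2 * (\<mu> - f) * (exp (T \<mu>) - exp (T f))"
          using exp_diff_mult_ge[OF Te[OF \<mu>] Te[OF fR]] unfolding TT .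
        then have "(y - x) / s\<^sup>2 * (exp e * ((y - x) / s\<^sup>2) * (\<mu> - f)\<^sup>2) \<le> (y - x) / s\<^sup>2 * ((\<mu> - f) * (exp (T \<mu>) - exp (T f)))"
          by (simp only: power2_eq_square mult_ac)
        then have "exp e * ((y - x) / s\<^sup>2) * (\<mu> - f)\<^sup>2 \<le> (\<mu> - f) * (exp (T \<mu>) - exp (T f))"
          using h mult_le_cancel_left_pos by blast
        moreover have "exp e * (y - x) / C\<^sup>2 * (\<mu> - f)\<^sup>2 \<le> exp e * ((y - x) / s\<^sup>2) * (\<mu> - f)\<^sup>2"
          unfolding times_divide_eq_right using s xy s0
          by (intro mult_right_mono frac_le power_mono) auto
        ultimately show ?thesis by linarith
      qed (simp add: T_def)
      show "d \<le> normal_density \<mu> s x"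
        unfolding d_def using xy \<mu> s c by (intro normal_density_lower) auto
    qed (use pw0 d in auto)
    \<comment> \<open>The half-line on the far side of the midpoint from \<open>f\<close>, cut to a
      bounded set.\<close>
    define S where "S = (if (a + b) / 2 \<le> f then {..a} \<inter> {-R1..R1} else {b..} \<inter> {-R2..R2})"
    have S: "S \<in> sets borel" "p \<le> prob S" by (auto simp: S_def p_def)
    have SR: "\<bar>\<mu>\<bar> \<le> R" if "\<mu> \<in> S" for \<mu>
    proof -
      have "\<bar>\<mu>\<bar> \<le> max R1 R2" using that by (auto simp: S_def abs_le_iff le_max_iff_disj split: if_splits)
      then show ?thesis by (simp add: R_def)
    qed
    have S2: "((b - a) / 2)\<^sup>2 \<le> (\<mu> - f)\<^sup>2" if "\<mu> \<in> S" for \<mu>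
    proof -
      have "\<bar>(b - a) / 2\<bar> \<le> \<bar>\<mu> - f\<bar>"
        using that ab by (auto simp: S_def abs_if field_simps split: if_splits)
      then show ?thesis by (simp only: abs_le_square_iff)
    qed
    define q where "q = exp e * (y - x) / C\<^sup>2 * ((b - a) / 2)\<^sup>2 * d"
    have q: "q \<ge> 0" using xy d by (simp add: q_def)
    have "q * p \<le> q * prob S" using q S by (intro mult_left_mono) auto
    also have "\<dots> = (LINT \<mu>|G. q * indicator S \<mu>)" using S by simp
    also have "\<dots> \<le> (LINT \<mu>|G. (\<mu> - f) * (exp (T \<mu>) - exp (T f)) * normal_density \<mu> s x)"
    proof (rule integral_mono)
      show "integrable G (\<lambda>\<mu>. (\<mu> - f) * (exp (T \<mu>) - exp (T f)) * normal_density \<mu> s x)"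
        using posterior_mean_increment(1)[OF s0, of x y] by (simp add: T_def f_def)
      fix \<mu>
      show "q * indicator S \<mu> \<le> (\<mu> - f) * (exp (T \<mu>) - exp (T f)) * normal_density \<mu> s x"
      proof (cases "\<mu> \<in> S")
        case True
        have "q \<le> exp e * (y - x) / C\<^sup>2 * (\<mu> - f)\<^sup>2 * d"
          unfolding q_def using xy d S2[OF True] by (intro mult_right_mono mult_left_mono) auto
        then show ?thesis using pw1[OF SR[OF True]] True by simp
      qed (use pw0 in simp)
      show "integrable G (\<lambda>\<mu>. q * indicator S \<mu>)"
        using S by (intro integrable_mult_right integrable_real_indicator) (auto simp: emeasure_eq_measure)
    qed
    also have "\<dots> = (posterior_mean G s y - f) * marginal s y"
      using posterior_mean_increment(2)[OF s0, of y x] by (simp add: T_def f_def)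
    also have "\<dots> \<le> (posterior_mean G s y - f) * (1 / c)"
    proof (rule mult_left_mono)
      have "1 / s \<le> 1 / c" using s c by (intro frac_le) auto
      then show "marginal s y \<le> 1 / c" using marginal_upper[OF s0, of y] by linarith
    qed (use posterior_mean_mono[OF s0 xy(2)] f_def in simp)
    finally have "c * (q * p) \<le> posterior_mean G s y - f" using c by (simp add: field_simps)
    moreover have "\<kappa> * (y - x) = c * (q * p)" by (simp add: \<kappa>_def q_def)
    ultimately show ?thesis by (simp add: f_def)
  qed
  then show ?thesis using \<kappa> by blast
qed

text \<open>Numerator and denominator are integrals of functions that are Lipschitz in \<mu>, so
  each moves by at most a multiple of the Wasserstein distance. With
  \<open>\<delta> = d / (2 * L1)\<close> the denominator for \<open>G'\<close> keeps at least half
  of the bound \<open>d\<close> valid for \<open>G\<close>, which makes the constants independent of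
  \<open>G'\<close>.\<close>

lemma posterior_mean_W1_lipschitz:
  assumes c: "0 < c" "c \<le> C" and K: "0 \<le> K"
  shows "\<exists>L>0. \<exists>\<delta>>0. \<forall>G' s x. moment_distribution G' \<longrightarrow> W1 G' G \<le> \<delta> \<longrightarrow>
    c \<le> s \<longrightarrow> s \<le> C \<longrightarrow> \<bar>x\<bar> \<le> K \<longrightarrow>
    \<bar>posterior_mean G' s x - posterior_mean G s x\<bar> \<le> L * W1 G' G"
proof -
  obtain B where B: "B > 0" "\<And>s x. c \<le> s \<Longrightarrow> s \<le> C \<Longrightarrow> \<bar>x\<bar> \<le> K \<Longrightarrow> \<bar>posterior_mean G s x\<bar> \<le> B"
    using posterior_mean_bounded[OF c, of K] by metis
  obtain d where d: "d > 0" "\<And>s x. c \<le> s \<Longrightarrow> s \<le> C \<Longrightarrow> \<bar>x\<bar> \<le> K \<Longrightarrow> d \<le> marginal s x"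
    using marginal_bounded_below[OF c, of K] by metis
  define L1 where "L1 = 1 / c\<^sup>2"
  define L2 where "L2 = 3 / c + K / c\<^sup>2"
  have L: "L1 > 0" "L2 > 0" using c K by (auto simp: L1_def L2_def intro: add_pos_nonneg)
  define L where "L = 2 * (L2 + B * L1) / d"
  have "\<bar>posterior_mean G' s x - posterior_mean G s x\<bar> \<le> L * W1 G' G"
    if G': "moment_distribution G'" and W: "W1 G' G \<le> d / (2 * L1)" and s: "c \<le> s" "s \<le> C" and x: "\<bar>x\<bar> \<le> K"
    for G' s x
  proof -
    interpret G': moment_distribution G' by fact
    have s0: "s > 0" using s c by simp
    define W where "W = W1 G' G"
    have W0: "W \<ge> 0" unfolding W_def
      by (rule W1_nonneg[OF G'.real_distribution_axioms real_distribution_axioms])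
    note lip = lipschitz_integral_W1[OF G'.real_distribution_axioms G'.first_moment real_distribution_axioms first_moment]
    have 1: "\<bar>G'.marginal s x - marginal s x\<bar> \<le> L1 * W"
      unfolding G'.marginal_def marginal_def W_def
      using normal_density_lipschitz[OF c(1) s(1)] L by (intro lip) (auto simp: L1_def)
    let ?N' = "LINT \<mu>|G'. \<mu> * normal_density \<mu> s x" and ?N = "LINT \<mu>|G. \<mu> * normal_density \<mu> s x"
    have 2: "\<bar>?N' - ?N\<bar> \<le> L2 * W"
      unfolding W_def using mean_normal_density_lipschitz[OF c(1) s(1) x] L by (intro lip) (auto simp: L2_def)
    have N: "?N = posterior_mean G s x * marginal s x" "?N' = posterior_mean G' s x * G'.marginal s x"
      using integral_centered[OF s0, of 0 x] G'.integral_centered[OF s0, of 0 x] by auto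
    have "L1 * W \<le> d / 2" using W L unfolding W_def by (simp add: field_simps)
    then have d': "d / 2 \<le> G'.marginal s x" using 1 d(2)[OF s x] by linarith
    let ?D = "posterior_mean G' s x - posterior_mean G s x"
    have "\<bar>?D\<bar> * (d / 2) \<le> \<bar>?D\<bar> * G'.marginal s x" using d' by (intro mult_left_mono) auto
    also have "\<dots> = \<bar>?D * G'.marginal s x\<bar>" using G'.marginal_pos[OF s0, of x] by (simp add: abs_mult)
    \<comment> \<open>This arrangement of the quotient difference involves only the posterior mean
      of the fixed prior, which is bounded by \<open>B\<close>; no bound for that of
      \<open>G'\<close> is required.\<close>
    also have "?D * G'.marginal s x = (?N' - ?N) - posterior_mean G s x * (G'.marginal s x - marginal s x)"
      unfolding N by (simp add: algebra_simps)
    also have "\<bar>\<dots>\<bar> \<le> \<bar>?N' - ?N\<bar> + \<bar>posterior_mean G s x\<bar> * \<bar>G'.marginal s x - marginal s x\<bar>"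
      by (rule order.trans[OF abs_triangle_ineq4]) (simp add: abs_mult)
    also have "\<dots> \<le> L2 * W + B * (L1 * W)"
      using 1 2 B(2)[OF s x] B(1) by (intro add_mono mult_mono) auto
    finally show ?thesis
      using d(1) by (simp add: L_def W_def field_simps)
  qed
  moreover have "L > 0" using L B(1) d(1) by (simp add: L_def add_pos_pos)
  moreover have "d / (2 * L1) > 0" using d L by simp
  ultimately show ?thesis by blast
qed

end

subsection \<open>Measurability in the prior\<close>

text \<open>Pushing \<open>L x\<close> forward along \<open>y \<mapsto> (x, y)\<close> gives a
  measure on the product that carries the parameter along, and the integrand becomes one fixed
  function on that product.\<close>

lemma integral_measurable_subprob_algebra2:
  fixes f :: "'a \<Rightarrow> 'b \<Rightarrow> real"
  assumes f [measurable]: "(\<lambda>(x, y). f x y) \<in> borel_measurable (M \<Otimes>\<^sub>M N)"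
    and L [measurable]: "L \<in> M \<rightarrow>\<^sub>M subprob_algebra N"
  shows "(\<lambda>x. integral\<^sup>L (L x) (f x)) \<in> borel_measurable M"
proof -
  note measurable_distr2 [measurable]
  have "(\<lambda>x. integral\<^sup>L (distr (L x) (M \<Otimes>\<^sub>M N) (\<lambda>y. (x, y))) (\<lambda>(x, y). f x y)) \<in> borel_measurable M"
    by measurable
  then show ?thesis
  proof (rule measurable_cong[THEN iffD1, rotated])
    fix x assume x: "x \<in> space M"
    have "(\<lambda>y. (x, y)) \<in> L x \<rightarrow>\<^sub>M M \<Otimes>\<^sub>M N"
      using measurable_Pair1'[OF x, of N] by (simp only: measurable_cong_sets[OF sets_kernel[OF L x] refl])
    from integral_distr[OF this f]
    show "integral\<^sup>L (distr (L x) (M \<Otimes>\<^sub>M N) (\<lambda>y. (x, y))) (\<lambda>(x, y). f x y) = integral\<^sup>L (L x) (f x)"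
      by simp
  qed
qed

lemma nondegenerate_W1_distributions_iff:
  "G \<in> nondegenerate_W1_distributions \<longleftrightarrow> prior G"
  by (auto simp: nondegenerate_W1_distributions_def prior_def prior_axioms_def
      moment_distribution_def moment_distribution_axioms_def)

lemma space_W1_borel [simp]: "space (W1_borel F) = F"
  unfolding W1_borel_def by (rule space_measure_of) auto

text \<open>Such integrals are continuous for the Wasserstein distance, with radius
  \<open>e / L\<close> for tolerance \<open>e\<close>, and the preimage of an open set is one of the
  generators of the Borel sets.\<close>

lemma lipschitz_integral_measurable:
  fixes h :: "real \<Rightarrow> real"
  assumes F: "F \<subseteq> nondegenerate_W1_distributions"
    and h: "\<And>x y. \<bar>h x - h y\<bar> \<le> L * \<bar>x - y\<bar>" "h \<in> borel_measurable borel" and L: "L > 0"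
  shows "(\<lambda>G. LINT x|G. h x) \<in> borel_measurable (W1_borel F)"
proof (rule borel_measurableI)
  fix U :: "real set" assume U: "open U"
  let ?V = "(\<lambda>G. LINT x|G. h x) -` U \<inter> space (W1_borel F)"
  have "\<exists>\<epsilon>>0. \<forall>G'\<in>F. W1 G G' < \<epsilon> \<longrightarrow> G' \<in> ?V" if G: "G \<in> ?V" for G
  proof -
    from G U obtain e where e: "e > 0" "ball (LINT x|G. h x) e \<subseteq> U"
      by (auto simp: open_contains_ball)
    have "G' \<in> ?V" if G': "G' \<in> F" "W1 G G' < e / L" for G'
    proof -
      interpret G: prior G using G F by (auto simp: nondegenerate_W1_distributions_iff)
      interpret G': prior G' using G' F by (auto simp: nondegenerate_W1_distributions_iff)
      have "\<bar>(LINT x|G. h x) - (LINT x|G'. h x)\<bar> \<le> L * W1 G G'"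
        by (rule lipschitz_integral_W1[OF G.real_distribution_axioms G.first_moment
              G'.real_distribution_axioms G'.first_moment h L])
      also have "\<dots> < e" using G'(2) L by (simp add: field_simps)
      finally have "(LINT x|G'. h x) \<in> U" using e(2) by (auto simp: dist_real_def)
      then show ?thesis using G'(1) by simp
    qed
    then show ?thesis using e(1) L by (intro exI[of _ "e / L"]) auto
  qed
  then have "?V \<in> {U. U \<subseteq> F \<and> (\<forall>G\<in>U. \<exists>\<epsilon>>0. \<forall>G'\<in>F. W1 G G' < \<epsilon> \<longrightarrow> G' \<in> U)}"
    by auto
  then show "?V \<in> sets (W1_borel F)"
    unfolding W1_borel_def by (subst sets_measure_of) auto
qed

text \<open>Links the sigma-algebra of the metric space of priors to the one used for kernels.
  Half-lines generate the Borel sets and are stable under intersection, and the indicator of a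
  half-line is a pointwise limit of Lipschitz ramps, whose integrals are already known to be
  measurable.\<close>

lemma ident_measurable_W1_borel:
  assumes F: "F \<subseteq> nondegenerate_W1_distributions"
  shows "(\<lambda>G. G) \<in> W1_borel F \<rightarrow>\<^sub>M prob_algebra borel"
proof (rule measurable_prob_algebra_generated[where \<Omega>=UNIV and G="range atMost"])
  show "sets (borel :: real measure) = sigma_sets UNIV (range atMost)"
    by (subst borel_eq_atMost) simp
  show "Int_stable (range atMost :: real set set)"
    by (auto simp: Int_stable_def)
  show "range atMost \<subseteq> Pow (UNIV :: real set)" by simp
  have pr: "prior G" if "G \<in> space (W1_borel F)" for G
    using that F by (auto simp: nondegenerate_W1_distributions_iff)
  show "prob_space G" if "G \<in> space (W1_borel F)" for G
  proof -
    interpret prior G by (rule pr[OF that])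
    show ?thesis by (rule prob_space_axioms)
  qed
  show "sets G = sets borel" if "G \<in> space (W1_borel F)" for G
  proof -
    interpret prior G by (rule pr[OF that])
    show ?thesis by (rule events_eq_borel)
  qed
  fix A :: "real set" assume "A \<in> range atMost"
  then obtain a where A: "A = {..a}" by auto
  \<comment> \<open>The ramp is 1 up to \<open>a\<close> and falls to 0 at a + 1 / (k + 1).
    \<open>Suc k\<close> keeps the Lipschitz constant positive for \<open>k = 0\<close> as
    well.\<close>
  define h :: "nat \<Rightarrow> real \<Rightarrow> real" where "h k x = max 0 (min 1 (1 - real (Suc k) * (x - a)))" for k x
  have h_meas: "h k \<in> borel_measurable borel" for k unfolding h_def by measurable
  have h_lip: "\<bar>h k x - h k y\<bar> \<le> real (Suc k) * \<bar>x - y\<bar>" for k x y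
  proof -
    have clamp: "\<bar>max 0 (min 1 (1 - u)) - max 0 (min 1 (1 - v))\<bar> \<le> \<bar>u - v\<bar>" for u v :: real
      by (auto simp: max_def min_def)
    have "\<bar>h k x - h k y\<bar> \<le> \<bar>real (Suc k) * (x - a) - real (Suc k) * (y - a)\<bar>"
      unfolding h_def by (rule clamp)
    also have "\<dots> = \<bar>real (Suc k) * (x - y)\<bar>" unfolding right_diff_distrib[symmetric] by simp
    also have "\<dots> = real (Suc k) * \<bar>x - y\<bar>" by (simp only: abs_mult abs_of_nat)
    finally show ?thesis .
  qed
  have lim: "(\<lambda>k. h k x) \<longlonglongrightarrow> indicator {..a} x" for x
  proof (cases "x \<le> a")
    case True
    then have "h k x = 1" for k
      unfolding h_def by (auto simp: max_def min_def mult_le_0_iff not_le zero_less_mult_iff)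
    then show ?thesis using True by simp
  next
    case False
    then obtain k0 where k0: "1 / (x - a) < real k0" using reals_Archimedean2 by blast
    have "h k x = 0" if "k \<ge> k0" for k
    proof -
      have "1 / (x - a) \<le> real (Suc k)" using k0 that by simp
      then have "1 \<le> real (Suc k) * (x - a)" using False by (simp only: pos_divide_le_eq diff_gt_0_iff_gt not_le)
      then show ?thesis by (simp only: h_def)
    qed
    then have "eventually (\<lambda>k. h k x = indicator {..a} x) sequentially"
      using False by (auto simp: eventually_sequentially)
    then show ?thesis by (rule tendsto_eventually)
  qed
  have "(\<lambda>G. measure G A) \<in> borel_measurable (W1_borel F)"
  proof (rule borel_measurable_LIMSEQ_real)
    show "(\<lambda>G. LINT x|G. h k x) \<in> borel_measurable (W1_borel F)" for k
      by (rule lipschitz_integral_measurable[OF F h_lip h_meas]) simp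
    fix G assume "G \<in> space (W1_borel F)"
    then interpret prior G by (rule pr)
    have "(\<lambda>k. LINT x|G. h k x) \<longlonglongrightarrow> (LINT x|G. indicator {..a} x)"
    proof (rule integral_dominated_convergence[where w="\<lambda>_. 1"])
      show "h k \<in> borel_measurable G" for k using h_meas by simp
      show "AE x in G. norm (h k x) \<le> 1" for k by (simp add: h_def)
    qed (use lim in auto)
    then show "(\<lambda>k. LINT x|G. h k x) \<longlonglongrightarrow> measure G A" by (simp add: A)
  qed
  then have "(\<lambda>G. ennreal (measure G A)) \<in> borel_measurable (W1_borel F)" by measurable
  then show "(\<lambda>G. emeasure G A) \<in> borel_measurable (W1_borel F)"
  proof (rule measurable_cong[THEN iffD1, rotated])
    fix G assume "G \<in> space (W1_borel F)"
    then interpret prior G by (rule pr)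
    show "ennreal (measure G A) = emeasure G A" by (simp add: emeasure_eq_measure)
  qed
qed

lemma measurable_posterior_mean:
  assumes L: "L \<in> P \<rightarrow>\<^sub>M prob_algebra borel"
    and [measurable]: "s \<in> borel_measurable P" "x \<in> borel_measurable P"
  shows "(\<lambda>\<omega>. posterior_mean (L \<omega>) (s \<omega>) (x \<omega>)) \<in> borel_measurable P"
proof -
  note L' = measurable_prob_algebraD[OF L]
  have "(\<lambda>\<omega>. LINT \<mu>|L \<omega>. \<mu> * (1 / s \<omega> * std_normal_density ((x \<omega> - \<mu>) / s \<omega>))) \<in> borel_measurable P"
    by (rule integral_measurable_subprob_algebra2[OF _ L']) measurable
  moreover have "(\<lambda>\<omega>. LINT \<mu>|L \<omega>. 1 / s \<omega> * std_normal_density ((x \<omega> - \<mu>) / s \<omega>)) \<in> borel_measurable P"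
    by (rule integral_measurable_subprob_algebra2[OF _ L']) measurable
  ultimately show ?thesis unfolding posterior_mean_def by measurable
qed

lemma measurable_top_indices:
  assumes t: "\<And>i. i \<in> {1..n} \<Longrightarrow> (\<lambda>\<omega>. t \<omega> i) \<in> borel_measurable P"
    and \<tau>: "\<tau> \<in> P \<rightarrow>\<^sub>M count_space S" and i: "i \<in> {1..n}"
  shows "(\<lambda>\<omega>. indicator (top_indices n m (t \<omega>) (\<tau> \<omega>)) i :: real) \<in> borel_measurable P"
proof -
  define Q where "Q j \<omega> \<longleftrightarrow> t \<omega> j > t \<omega> i \<or> t \<omega> j = t \<omega> i \<and> \<tau> \<omega> j < \<tau> \<omega> i" for j \<omega>
  have Q: "Measurable.pred P (Q j)" if j: "j \<in> {1..n}" for j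
  proof -
    note [measurable] = t[OF i] t[OF j]
    have [measurable]: "Measurable.pred P (\<lambda>\<omega>. \<tau> \<omega> j < \<tau> \<omega> i)"
      by (rule measurable_compose[OF \<tau>]) simp
    show ?thesis unfolding Q_def by measurable
  qed
  have eq: "indicator (top_indices n m (t \<omega>) (\<tau> \<omega>)) i =
      (if (\<Sum>j\<in>{1..n}. if Q j \<omega> then 1 else 0 :: real) < real m then 1 else 0 :: real)" for \<omega>
    using i by (simp add: top_indices_def Q_def indicator_def sum.If_cases Int_def)
  have "(\<lambda>\<omega>. \<Sum>j\<in>{1..n}. if Q j \<omega> then 1 else 0 :: real) \<in> borel_measurable P"
  proof (rule borel_measurable_sum)
    fix j assume "j \<in> {1..n}"
    note [measurable] = Q[OF this]
    show "(\<lambda>\<omega>. if Q j \<omega> then 1 else 0 :: real) \<in> borel_measurable P" by measurable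
  qed
  then show ?thesis unfolding eq by measurable
qed

lemma measurable_regret:
  assumes t: "\<And>i. i \<in> {1..n} \<Longrightarrow> (\<lambda>\<omega>. t \<omega> i) \<in> borel_measurable P"
    and t': "\<And>i. i \<in> {1..n} \<Longrightarrow> (\<lambda>\<omega>. t' \<omega> i) \<in> borel_measurable P"
    and \<tau>: "\<tau> \<in> P \<rightarrow>\<^sub>M count_space S" "\<tau>' \<in> P \<rightarrow>\<^sub>M count_space S"
  shows "(\<lambda>\<omega>. regret n m (t \<omega>) (t' \<omega>) (\<tau> \<omega>) (\<tau>' \<omega>)) \<in> borel_measurable P"
  unfolding regret_def
  by (intro borel_measurable_times borel_measurable_const borel_measurable_sum borel_measurable_diff t
      measurable_top_indices[OF t \<tau>(1)] measurable_top_indices[OF t' \<tau>(2)])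

subsection \<open>Exchanged indices\<close>

text \<open>Equal cardinalities make the two set differences equally large, and any bijection
  between them pairs the exchanged elements; the common part cancels. Since \<open>w\<close> bounds
  all pairs, the choice of the bijection is irrelevant.\<close>

lemma sum_diff_exchange:
  fixes \<theta> :: "'a \<Rightarrow> real"
  assumes fin: "finite A" "finite B" and card: "card A = card B"
    and w: "\<And>i j. i \<in> A - B \<Longrightarrow> j \<in> B - A \<Longrightarrow> \<bar>\<theta> i - \<theta> j\<bar> \<le> w"
  shows "\<bar>sum \<theta> A - sum \<theta> B\<bar> \<le> w * real (card (A - B))"
proof -
  have "card (A - B) = card (B - A)"
    using card_Diff_subset_Int[of A B] card_Diff_subset_Int[of B A] fin card by (simp add: Int_commute)
  then obtain g where g: "bij_betw g (A - B) (B - A)"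
    using finite_same_card_bij fin by (metis finite_Diff)
  have "sum \<theta> A - sum \<theta> B = sum \<theta> (A - B) - sum \<theta> (B - A)"
    using sum.Int_Diff[OF fin(1), of \<theta> B] sum.Int_Diff[OF fin(2), of \<theta> A] by (simp add: Int_commute)
  also have "sum \<theta> (B - A) = (\<Sum>i\<in>A - B. \<theta> (g i))"
    using sum.reindex_bij_betw[OF g, of \<theta>] by simp
  finally have "\<bar>sum \<theta> A - sum \<theta> B\<bar> = \<bar>\<Sum>i\<in>A - B. \<theta> i - \<theta> (g i)\<bar>"
    by (simp add: sum_subtractf)
  also have "\<dots> \<le> (\<Sum>i\<in>A - B. \<bar>\<theta> i - \<theta> (g i)\<bar>)" by (rule sum_abs)
  also have "\<dots> \<le> (\<Sum>i\<in>A - B. w)"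
    using g by (intro sum_mono w) (auto simp: bij_betw_def)
  finally show ?thesis by (simp add: mult.commute)
qed

text \<open>Counting ties as ranked before \<open>i\<close> gives a condition that holds for every
  tie-breaking. Dually, \<open>not_top_indicesI\<close> counts strictly larger values only.\<close>

lemma top_indicesI:
  assumes "i \<in> {1..n}" "{j\<in>{1..n}. t i \<le> t j} \<subseteq> S" "finite S" "card S < m"
  shows "i \<in> top_indices n m t p"
proof -
  have "card {j\<in>{1..n}. t j > t i \<or> t j = t i \<and> p j < p i} \<le> card S"
    using assms by (intro card_mono) auto
  then show ?thesis using assms by (simp add: top_indices_def)
qed

lemma not_top_indicesI:
  assumes "S \<subseteq> {j\<in>{1..n}. t i < t j}" "m \<le> card S"
  shows "i \<notin> top_indices n m t p"
proof -
  have "card S \<le> card {j\<in>{1..n}. t j > t i \<or> t j = t i \<and> p j < p i}"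
    using assms by (intro card_mono) auto
  then show ?thesis using assms by (auto simp: top_indices_def)
qed

text \<open>\<open>low\<close> excludes every index strictly below \<open>t1\<close> and
  \<open>high\<close> selects every index strictly above \<open>t2\<close>; \<open>out\<close> says
  that an index outside \<open>I\<close> is in one of these positions for both rankings, so
  exchanges happen only inside \<open>I\<close>. The position \<open>u\<close> of the window depends
  on the data and is therefore only asserted to exist.\<close>

lemma regret_window:
  assumes m: "m \<le> n" and p: "p permutes {1..n}" "p' permutes {1..n}"
    and \<eta>: "\<And>i. i \<in> I \<Longrightarrow> \<bar>\<theta>' i - \<theta> i\<bar> \<le> \<eta>" "\<eta> \<ge> 0"
    and low: "m \<le> card {j\<in>{1..n}. t1 \<le> \<theta> j}" and high: "card {j\<in>{1..n}. t2 < \<theta> j} < m"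
    and out: "\<And>i. i \<in> {1..n} - I \<Longrightarrow>
      t2 < \<theta> i \<and> {j\<in>{1..n}. \<theta>' i \<le> \<theta>' j} \<subseteq> {j\<in>{1..n}. t2 < \<theta> j} \<or>
      \<theta> i < t1 \<and> (\<forall>j\<in>{1..n}. t1 \<le> \<theta> j \<longrightarrow> \<theta>' i < \<theta>' j)"
  shows "\<exists>u. \<bar>regret n m \<theta> \<theta>' p p'\<bar> \<le>
    2 * \<eta> / real n * real (card {i\<in>{1..n} \<inter> I. u \<le> \<theta> i \<and> \<theta> i \<le> u + 2 * \<eta>})"
proof -
  define J where "J = top_indices n m \<theta> p"
  define J' where "J' = top_indices n m \<theta>' p'"
  have sub: "J \<subseteq> {1..n}" "J' \<subseteq> {1..n}" by (auto simp: J_def J'_def top_indices_def)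
  then have fin: "finite J" "finite J'" using finite_subset by blast+
  have card: "card J = card J'"
    unfolding J_def J'_def by (simp only: top_indices_correct(1)[OF p(1) m] top_indices_correct(1)[OF p(2) m])
  have same: "i \<in> J \<longleftrightarrow> i \<in> J'" if i: "i \<in> {1..n} - I" for i
    using out[OF i]
  proof (elim disjE conjE)
    assume *: "t2 < \<theta> i" "{j\<in>{1..n}. \<theta>' i \<le> \<theta>' j} \<subseteq> {j\<in>{1..n}. t2 < \<theta> j}"
    have i': "i \<in> {1..n}" using i by simp
    have "{j\<in>{1..n}. \<theta> i \<le> \<theta> j} \<subseteq> {j\<in>{1..n}. t2 < \<theta> j}" using *(1) by auto
    from top_indicesI[OF i' this _ high] have "i \<in> J" unfolding J_def by simp
    moreover from top_indicesI[OF i' *(2) _ high] have "i \<in> J'" unfolding J'_def by simp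
    ultimately show ?thesis by blast
  next
    assume *: "\<theta> i < t1" "\<forall>j\<in>{1..n}. t1 \<le> \<theta> j \<longrightarrow> \<theta>' i < \<theta>' j"
    have "{j\<in>{1..n}. t1 \<le> \<theta> j} \<subseteq> {j\<in>{1..n}. \<theta> i < \<theta> j}" using *(1) by auto
    from not_top_indicesI[OF this low] have "i \<notin> J" unfolding J_def .
    moreover have "{j\<in>{1..n}. t1 \<le> \<theta> j} \<subseteq> {j\<in>{1..n}. \<theta>' i < \<theta>' j}" using *(2) by blast
    from not_top_indicesI[OF this low] have "i \<notin> J'" unfolding J'_def .
    ultimately show ?thesis by blast
  qed
  have inI: "i \<in> I" if "i \<in> J - J' \<or> i \<in> J' - J" for i
    using same[of i] that sub by blast
  \<comment> \<open>The oracle ranks \<open>i\<close> no lower than \<open>j\<close>, the estimate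
    ranks \<open>j\<close> no lower than \<open>i\<close>, and each of the two values moves by at
    most \<eta>.\<close>
  have close: "0 \<le> \<theta> i - \<theta> j \<and> \<theta> i - \<theta> j \<le> 2 * \<eta>" if ij: "i \<in> J - J'" "j \<in> J' - J" for i j
  proof -
    have "\<theta> j \<le> \<theta> i"
      using top_indices_correct(2)[OF p(1) m, of i \<theta> j] ij sub by (auto simp: J_def)
    moreover have "\<theta>' i \<le> \<theta>' j"
      using top_indices_correct(2)[OF p(2) m, of j \<theta>' i] ij sub by (auto simp: J'_def)
    moreover have "\<bar>\<theta>' i - \<theta> i\<bar> \<le> \<eta>" "\<bar>\<theta>' j - \<theta> j\<bar> \<le> \<eta>" using \<eta> inI ij by auto
    ultimately show ?thesis by linarith
  qed
  have ind: "sum (\<lambda>i. indicator A i * \<theta> i) {1..n} = sum \<theta> A" if "A \<subseteq> {1..n}" for A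
    by (rule sum.mono_neutral_cong_right[OF _ that]) simp_all
  have "sum (\<lambda>i. indicator J i * \<theta> i) {1..n} = sum \<theta> J" "sum (\<lambda>i. indicator J' i * \<theta> i) {1..n} = sum \<theta> J'"
    by (rule ind[OF sub(1)], rule ind[OF sub(2)])
  then have reg: "regret n m \<theta> \<theta>' p p' = (sum \<theta> J - sum \<theta> J') / real n"
    unfolding regret_def J_def[symmetric] J'_def[symmetric] left_diff_distrib sum_subtractf by simp
  have "\<bar>sum \<theta> J - sum \<theta> J'\<bar> \<le> 2 * \<eta> * real (card (J - J'))"
    by (rule sum_diff_exchange[OF fin card]) (use close in force)
  \<comment> \<open>One index \<open>j\<close> that only the estimate selects anchors the window for
    all indices that it drops. If there is none, equal cardinalities force \<open>J' = J\<close> and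
    every \<open>u\<close> works.\<close>
  moreover have "\<exists>u. J - J' \<subseteq> {i\<in>{1..n} \<inter> I. u \<le> \<theta> i \<and> \<theta> i \<le> u + 2 * \<eta>}"
  proof (cases "J' - J = {}")
    case True
    then have "J' = J" using card_subset_eq[OF fin(1), of J'] card by auto
    then show ?thesis by auto
  next
    case False
    then obtain j where j: "j \<in> J' - J" by blast
    have "J - J' \<subseteq> {i\<in>{1..n} \<inter> I. \<theta> j \<le> \<theta> i \<and> \<theta> i \<le> \<theta> j + 2 * \<eta>}"
    proof
      fix i assume i: "i \<in> J - J'"
      then show "i \<in> {i\<in>{1..n} \<inter> I. \<theta> j \<le> \<theta> i \<and> \<theta> i \<le> \<theta> j + 2 * \<eta>}"
        using close[OF i j] inI[of i] sub by auto
    qed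
    then show ?thesis by blast
  qed
  then obtain u where u: "J - J' \<subseteq> {i\<in>{1..n} \<inter> I. u \<le> \<theta> i \<and> \<theta> i \<le> u + 2 * \<eta>}" by blast
  have "card (J - J') \<le> card {i\<in>{1..n} \<inter> I. u \<le> \<theta> i \<and> \<theta> i \<le> u + 2 * \<eta>}"
    by (rule card_mono[OF _ u]) simp
  then have "2 * \<eta> * real (card (J - J')) \<le> 2 * \<eta> * real (card {i\<in>{1..n} \<inter> I. u \<le> \<theta> i \<and> \<theta> i \<le> u + 2 * \<eta>})"
    using \<eta>(2) by (intro mult_left_mono) auto
  ultimately have "\<bar>sum \<theta> J - sum \<theta> J'\<bar> \<le> 2 * \<eta> * real (card {i\<in>{1..n} \<inter> I. u \<le> \<theta> i \<and> \<theta> i \<le> u + 2 * \<eta>})"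
    by linarith
  from divide_right_mono[OF this, of "real n"] show ?thesis
    unfolding reg by (intro exI[of _ u]) (simp add: abs_divide)
qed

text \<open>Wherever a window of length \<open>w\<close> lies, it meets at most w / r + 2 cells of
  length \<open>r\<close>, so a bound valid for every cell of a fixed grid serves all windows at
  once.\<close>

lemma card_window_le_cells:
  fixes \<theta> :: "nat \<Rightarrow> real"
  assumes I: "finite I" and r: "r > 0" and w: "w \<ge> 0" and b: "b \<ge> 0"
    and cell: "\<And>k. real (card {i\<in>I. \<lfloor>\<theta> i / r\<rfloor> = k}) \<le> b"
  shows "real (card {i\<in>I. u \<le> \<theta> i \<and> \<theta> i \<le> u + w}) \<le> (w / r + 2) * b"
proof -
  define F where "F = {\<lfloor>u / r\<rfloor>..\<lfloor>(u + w) / r\<rfloor>}"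
  have "{i\<in>I. u \<le> \<theta> i \<and> \<theta> i \<le> u + w} \<subseteq> (\<Union>k\<in>F. {i\<in>I. \<lfloor>\<theta> i / r\<rfloor> = k})"
    using r by (auto simp: F_def intro!: floor_mono divide_right_mono)
  then have "card {i\<in>I. u \<le> \<theta> i \<and> \<theta> i \<le> u + w} \<le> card (\<Union>k\<in>F. {i\<in>I. \<lfloor>\<theta> i / r\<rfloor> = k})"
    using I by (intro card_mono) (auto simp: F_def)
  also have "\<dots> \<le> (\<Sum>k\<in>F. card {i\<in>I. \<lfloor>\<theta> i / r\<rfloor> = k})"
    by (rule card_UN_le) (simp add: F_def)
  finally have "real (card {i\<in>I. u \<le> \<theta> i \<and> \<theta> i \<le> u + w}) \<le> real (\<Sum>k\<in>F. card {i\<in>I. \<lfloor>\<theta> i / r\<rfloor> = k})"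
    by (simp only: of_nat_le_iff)
  also have "\<dots> = (\<Sum>k\<in>F. real (card {i\<in>I. \<lfloor>\<theta> i / r\<rfloor> = k}))" by simp
  also have "\<dots> \<le> (\<Sum>k\<in>F. b)" by (intro sum_mono cell)
  also have "\<dots> = real (card F) * b" by simp
  also have "\<dots> \<le> (w / r + 2) * b"
  proof (rule mult_right_mono[OF _ b])
    have "\<lfloor>u / r\<rfloor> \<le> \<lfloor>(u + w) / r\<rfloor>" using r w by (intro floor_mono divide_right_mono) auto
    then have "real (card F) = real_of_int (\<lfloor>(u + w) / r\<rfloor> - \<lfloor>u / r\<rfloor> + 1)" by (simp add: F_def)
    also have "\<dots> \<le> w / r + 2" unfolding add_divide_distrib by linarith
    finally show "real (card F) \<le> w / r + 2" .
  qed
  finally show ?thesis .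
qed

subsection \<open>Cell counts\<close>

text \<open>Off the diagonal the expectations factor by independence and vanish by
  centering.\<close>

lemma (in prob_space) expectation_square_sum_indep:
  fixes Y :: "'i \<Rightarrow> 'a \<Rightarrow> real"
  assumes fin: "finite I" and indep: "indep_vars (\<lambda>_. borel) Y I"
    and int: "\<And>i. i \<in> I \<Longrightarrow> integrable M (Y i)" "\<And>i. i \<in> I \<Longrightarrow> integrable M (\<lambda>\<omega>. (Y i \<omega>)\<^sup>2)"
    and zero: "\<And>i. i \<in> I \<Longrightarrow> expectation (Y i) = 0"
  shows "integrable M (\<lambda>\<omega>. (\<Sum>i\<in>I. Y i \<omega>)\<^sup>2)"
    and "expectation (\<lambda>\<omega>. (\<Sum>i\<in>I. Y i \<omega>)\<^sup>2) = (\<Sum>i\<in>I. expectation (\<lambda>\<omega>. (Y i \<omega>)\<^sup>2))"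
proof -
  have pair: "integrable M (\<lambda>\<omega>. Y i \<omega> * Y j \<omega>)"
      "expectation (\<lambda>\<omega>. Y i \<omega> * Y j \<omega>) = (if i = j then expectation (\<lambda>\<omega>. (Y i \<omega>)\<^sup>2) else 0)"
    if ij: "i \<in> I" "j \<in> I" for i j
  proof -
    have "integrable M (\<lambda>\<omega>. Y i \<omega> * Y j \<omega>) \<and>
      expectation (\<lambda>\<omega>. Y i \<omega> * Y j \<omega>) = (if i = j then expectation (\<lambda>\<omega>. (Y i \<omega>)\<^sup>2) else 0)"
    proof (cases "i = j")
      case True
      then show ?thesis using int(2)[OF ij(1)] by (simp add: power2_eq_square)
    next
      case False
      have "indep_vars (\<lambda>_. borel) Y {i, j}" using indep_vars_subset[OF indep] ij by simp
      note * = indep_vars_lebesgue_integral[OF _ this] indep_vars_integrable[OF _ this]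
      have "integrable M (\<lambda>\<omega>. \<Prod>k\<in>{i, j}. Y k \<omega>)" by (rule *(2)) (use ij int in auto)
      moreover have "expectation (\<lambda>\<omega>. \<Prod>k\<in>{i, j}. Y k \<omega>) = (\<Prod>k\<in>{i, j}. expectation (Y k))"
        by (rule *(1)) (use ij int in auto)
      ultimately show ?thesis using False ij zero by simp
    qed
    then show "integrable M (\<lambda>\<omega>. Y i \<omega> * Y j \<omega>)"
      "expectation (\<lambda>\<omega>. Y i \<omega> * Y j \<omega>) = (if i = j then expectation (\<lambda>\<omega>. (Y i \<omega>)\<^sup>2) else 0)" by auto
  qed
  have eq: "(\<lambda>\<omega>. (\<Sum>i\<in>I. Y i \<omega>)\<^sup>2) = (\<lambda>\<omega>. \<Sum>i\<in>I. \<Sum>j\<in>I. Y i \<omega> * Y j \<omega>)"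
    by (simp add: power2_eq_square sum_product)
  show "integrable M (\<lambda>\<omega>. (\<Sum>i\<in>I. Y i \<omega>)\<^sup>2)"
    unfolding eq by (intro Bochner_Integration.integrable_sum pair)
  have "expectation (\<lambda>\<omega>. (\<Sum>i\<in>I. Y i \<omega>)\<^sup>2) = (\<Sum>i\<in>I. \<Sum>j\<in>I. expectation (\<lambda>\<omega>. Y i \<omega> * Y j \<omega>))"
    unfolding eq
    by (subst Bochner_Integration.integral_sum, intro Bochner_Integration.integrable_sum pair,
        assumption, assumption, intro sum.cong refl Bochner_Integration.integral_sum pair)
  also have "\<dots> = (\<Sum>i\<in>I. \<Sum>j\<in>I. if i = j then expectation (\<lambda>\<omega>. (Y i \<omega>)\<^sup>2) else 0)"
    by (intro sum.cong refl pair(2))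
  also have "\<dots> = (\<Sum>i\<in>I. expectation (\<lambda>\<omega>. (Y i \<omega>)\<^sup>2))"
    using fin by simp
  finally show "expectation (\<lambda>\<omega>. (\<Sum>i\<in>I. Y i \<omega>)\<^sup>2) = (\<Sum>i\<in>I. expectation (\<lambda>\<omega>. (Y i \<omega>)\<^sup>2))" .
qed

text \<open>The binomial variance n p (1 - p) is relaxed to n p: being linear in p, this bound adds
  up to at most n over disjoint sets.\<close>

lemma (in prob_space) expectation_square_count:
  fixes Z :: "'i \<Rightarrow> 'a \<Rightarrow> 'b"
  assumes fin: "finite I" and indep: "indep_vars (\<lambda>_. N) Z I"
    and law: "\<And>i. i \<in> I \<Longrightarrow> distr M N (Z i) = Q" and A: "A \<in> sets N"
  shows "integrable M (\<lambda>\<omega>. (real (card {i\<in>I. Z i \<omega> \<in> A}) - real (card I) * measure Q A)\<^sup>2)"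
    and "expectation (\<lambda>\<omega>. (real (card {i\<in>I. Z i \<omega> \<in> A}) - real (card I) * measure Q A)\<^sup>2) \<le>
      real (card I) * measure Q A"
proof -
  define p where "p = measure Q A"
  define Y where "Y i \<omega> = indicator A (Z i \<omega>) - p" for i \<omega>
  note [measurable] = A
  have Z [measurable]: "Z i \<in> M \<rightarrow>\<^sub>M N" if "i \<in> I" for i
    using indep that by (auto simp: indep_vars_def)
  have Yi: "indep_vars (\<lambda>_. borel) Y I"
    unfolding Y_def by (rule indep_vars_compose2[OF indep]) measurable
  have ind: "integrable M (\<lambda>\<omega>. indicator A (Z i \<omega>) :: real)"
    "expectation (\<lambda>\<omega>. indicator A (Z i \<omega>) :: real) = p" if i: "i \<in> I" for i
  proof -
    note [measurable] = Z[OF i]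
    show "integrable M (\<lambda>\<omega>. indicator A (Z i \<omega>) :: real)"
      by (rule integrable_const_bound[of _ 1]) auto
    have "p = prob (Z i -` A \<inter> space M)"
      unfolding p_def law[OF i, symmetric] by (rule measure_distr) measurable
    also have "\<dots> = expectation (indicator (Z i -` A \<inter> space M))"
      by simp
    also have "\<dots> = expectation (\<lambda>\<omega>. indicator A (Z i \<omega>))"
      by (rule Bochner_Integration.integral_cong) (auto split: split_indicator)
    finally show "expectation (\<lambda>\<omega>. indicator A (Z i \<omega>) :: real) = p" by simp
  qed
  have int: "integrable M (Y i)" "expectation (Y i) = 0" if "i \<in> I" for i
  proof -
    have Y: "Y i = (\<lambda>\<omega>. indicator A (Z i \<omega>) - p)" by (simp add: fun_eq_iff Y_def)
    show "integrable M (Y i)" unfolding Y using ind[OF that] by simp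
    show "expectation (Y i) = 0" unfolding Y using ind[OF that] by (simp add: prob_space)
  qed
  \<comment> \<open>An indicator equals its square, so the squared deviation is affine in it and its
    integrability and expectation follow from those of the indicator.\<close>
  have Ysq: "(Y i \<omega>)\<^sup>2 = (1 - 2 * p) * indicator A (Z i \<omega>) + p\<^sup>2" for i \<omega>
    by (auto simp: Y_def power2_eq_square algebra_simps split: split_indicator)
  have sq: "integrable M (\<lambda>\<omega>. (Y i \<omega>)\<^sup>2)" "expectation (\<lambda>\<omega>. (Y i \<omega>)\<^sup>2) = p - p\<^sup>2" if "i \<in> I" for i
  proof -
    show "integrable M (\<lambda>\<omega>. (Y i \<omega>)\<^sup>2)" unfolding Ysq using ind(1)[OF that] by simp
    have "expectation (\<lambda>\<omega>. (Y i \<omega>)\<^sup>2) = (1 - 2 * p) * p + p\<^sup>2"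
      unfolding Ysq using ind(1)[OF that] ind(2)[OF that] by (simp add: prob_space)
    then show "expectation (\<lambda>\<omega>. (Y i \<omega>)\<^sup>2) = p - p\<^sup>2"
      by (simp add: power2_eq_square algebra_simps)
  qed
  have count: "real (card {i\<in>I. Z i \<omega> \<in> A}) - real (card I) * p = (\<Sum>i\<in>I. Y i \<omega>)" for \<omega>
    using fin by (simp add: Y_def sum_subtractf indicator_def sum.If_cases Int_def)
  note * = expectation_square_sum_indep[OF fin Yi int(1) sq(1) int(2)]
  show "integrable M (\<lambda>\<omega>. (real (card {i\<in>I. Z i \<omega> \<in> A}) - real (card I) * measure Q A)\<^sup>2)"
    using *(1) unfolding count[unfolded p_def] .
  have "expectation (\<lambda>\<omega>. (\<Sum>i\<in>I. Y i \<omega>)\<^sup>2) = (\<Sum>i\<in>I. p - p\<^sup>2)"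
    using *(2) sq(2) by simp
  also have "\<dots> \<le> (\<Sum>i\<in>I. p)" by (intro sum_mono) simp
  finally show "expectation (\<lambda>\<omega>. (real (card {i\<in>I. Z i \<omega> \<in> A}) - real (card I) * measure Q A)\<^sup>2) \<le>
      real (card I) * measure Q A"
    unfolding count[unfolded p_def] p_def by simp
qed

text \<open>Because the cells are disjoint, the second moments add up to at most the sample size,
  however many cells there are.\<close>

lemma (in prob_space) cell_counts_concentrate:
  fixes Z :: "'i \<Rightarrow> 'a \<Rightarrow> 'b" and A :: "'k \<Rightarrow> 'b set" and F :: "'k set"
  assumes fin: "finite I" "I \<noteq> {}" and indep: "indep_vars (\<lambda>_. N) Z I"
    and law: "\<And>i. i \<in> I \<Longrightarrow> distr M N (Z i) = Q" and F: "finite F"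
    and A: "\<And>k. k \<in> F \<Longrightarrow> A k \<in> sets N" "disjoint_family_on A F" and a: "a > 0"
  defines "U \<equiv> \<lambda>\<omega>. \<Sum>k\<in>F. (real (card {i\<in>I. Z i \<omega> \<in> A k}) - real (card I) * measure Q (A k))\<^sup>2"
  shows "{\<omega>\<in>space M. U \<omega> \<ge> real (card I) * a} \<in> events"
    and "prob {\<omega>\<in>space M. U \<omega> \<ge> real (card I) * a} \<le> 1 / a"
proof -
  have card: "real (card I) > 0" using fin by (simp add: card_gt_0_iff)
  note sq = expectation_square_count[OF fin(1) indep law A(1)]
  have int: "integrable M U"
    unfolding U_def by (intro Bochner_Integration.integrable_sum sq) auto
  then show ev: "{\<omega>\<in>space M. U \<omega> \<ge> real (card I) * a} \<in> events" by measurable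
  obtain i where i: "i \<in> I" using fin by blast
  have "Z i \<in> M \<rightarrow>\<^sub>M N" using indep i by (auto simp: indep_vars_def)
  then interpret Q: prob_space Q
    using law[OF i] prob_space_distr by metis
  have sQ: "sets Q = sets N" using law[OF i] by (metis sets_distr)
  have "(\<Sum>k\<in>F. measure Q (A k)) = measure Q (\<Union>k\<in>F. A k)"
    using A F by (intro Q.finite_measure_finite_Union[symmetric]) (auto simp: sQ)
  then have p: "(\<Sum>k\<in>F. measure Q (A k)) \<le> 1" by simp
  have "expectation U = (\<Sum>k\<in>F. expectation (\<lambda>\<omega>. (real (card {i\<in>I. Z i \<omega> \<in> A k}) - real (card I) * measure Q (A k))\<^sup>2))"
    unfolding U_def by (intro Bochner_Integration.integral_sum sq) auto
  also have "\<dots> \<le> (\<Sum>k\<in>F. real (card I) * measure Q (A k))"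
    by (intro sum_mono sq) auto
  also have "\<dots> \<le> real (card I)"
    using p card by (simp add: sum_distrib_left[symmetric])
  finally have E: "expectation U \<le> real (card I)" .
  have "prob {\<omega>\<in>space M. U \<omega> \<ge> real (card I) * a} \<le> expectation U / (real (card I) * a)"
    using int a card by (intro integral_Markov_inequality_measure[where A="{}"]) (auto simp: U_def intro!: sum_nonneg)
  also have "\<dots> \<le> real (card I) / (real (card I) * a)"
    using E a card by (intro divide_right_mono) auto
  also have "\<dots> = 1 / a" using card by simp
  finally show "prob {\<omega>\<in>space M. U \<omega> \<ge> real (card I) * a} \<le> 1 / a" .
qed

subsection \<open>The hierarchical law\<close>

text \<open>Each point outside the support has a null open neighbourhood, which contains a basic
  open set around the point. The basis is countable, so all these basic sets together form a null
  set.\<close>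

lemma AE_measure_support:
  assumes "real_distribution H"
  shows "AE s in H. s \<in> measure_support H"
proof -
  interpret real_distribution H by fact
  obtain B :: "real set set" where B: "countable B" "topological_basis B"
    using ex_countable_basis by blast
  define B0 where "B0 = {b\<in>B. emeasure H b = 0}"
  have "b \<in> null_sets H" if "b \<in> B0" for b
    using that topological_basis_open[OF B(2)] by (auto simp: B0_def)
  then have "(\<Union>b\<in>B0. b) \<in> null_sets H"
    using B(1) by (intro null_sets_UN') (auto simp: B0_def)
  then have "AE s in H. s \<notin> (\<Union>b\<in>B0. b)" by (rule AE_not_in)
  then show ?thesis
  proof eventually_elim
    case (elim s)
    show ?case
    proof (rule ccontr)
      assume "s \<notin> measure_support H"
      then obtain U where U: "open U" "s \<in> U" "emeasure H U = 0"
        by (auto simp: measure_support_def)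
      then obtain b where b: "b \<in> B" "s \<in> b" "b \<subseteq> U"
        using B(2) by (meson topological_basisE)
      then have "emeasure H b = 0"
        using U by (metis borel_open emeasure_eq_0 events_eq_borel)
      then show False using elim b by (auto simp: B0_def)
    qed
  qed
qed

text \<open>As \<open>t\<close> rises through the levels with prior mass beyond them, the events
  \<open>t < T \<omega>\<close> shrink to a null set, so one of them has probability below \<alpha>.
  The upper end of the support may be infinite and is therefore expressed by mass beyond some
  \<open>b > t\<close>. With oracle values for \<open>T\<close>, this keeps the selection threshold
  away from the end of their range.\<close>

lemma exists_tail_level:
  assumes Q: "prob_space Q" and T: "T \<in> borel_measurable Q" and G: "real_distribution G"
    and pos: "AE \<omega> in Q. measure G {T \<omega><..} > 0" and \<alpha>: "\<alpha> > 0"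
  shows "\<exists>t b. t < b \<and> measure G {b<..} > 0 \<and> measure Q {\<omega>\<in>space Q. t < T \<omega>} < \<alpha>"
proof -
  interpret Q: prob_space Q by fact
  interpret G: real_distribution G by fact
  note [measurable] = T
  \<comment> \<open>Rational levels make the family countable, so that continuity from above applies
    along a sequence.\<close>
  define U where "U = {t\<in>\<rat>. \<exists>b>t. measure G {b<..} > 0}"
  have ae: "AE \<omega> in Q. \<exists>t\<in>U. T \<omega> \<le> t"
    using pos
  proof eventually_elim
    case (elim \<omega>)
    then obtain b where b: "T \<omega> < b" "measure G {b<..} > 0" using G.prob_greaterThan_pos by blast
    from Rats_dense_in_real[OF b(1)] obtain t where "t \<in> \<rat>" "T \<omega> < t" "t < b" by blast
    then show ?case using b(2) by (intro bexI[of _ t]) (auto simp: U_def)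
  qed
  have cU: "countable U" by (rule countable_subset[OF _ countable_rat]) (auto simp: U_def)
  have "U \<noteq> {}"
  proof
    assume "U = {}"
    with ae have "AE \<omega> in Q. False" by simp
    then show False using Q.AE_False by blast
  qed
  \<comment> \<open>Running maxima of an enumeration make the events nested, and a maximum of
    finitely many members stays in \<open>U\<close>.\<close>
  define u where "u k = Max (from_nat_into U ` {..k})" for k :: nat
  have uU: "u k \<in> U" for k
  proof -
    have "u k \<in> from_nat_into U ` {..k}" unfolding u_def by (rule Max_in) auto
    then show ?thesis using from_nat_into[OF \<open>U \<noteq> {}\<close>] by auto
  qed
  define A where "A k = {\<omega>\<in>space Q. u k < T \<omega>}" for k
  have "decseq A"
  proof (rule decseq_SucI)
    fix k
    have "u k \<le> u (Suc k)" unfolding u_def by (intro Max_mono) auto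
    then show "A (Suc k) \<subseteq> A k" by (auto simp: A_def)
  qed
  moreover have "range A \<subseteq> sets Q" by (auto simp: A_def)
  ultimately have "(\<lambda>k. measure Q (A k)) \<longlonglongrightarrow> measure Q (\<Inter>k. A k)"
    by (intro Q.finite_Lim_measure_decseq)
  moreover have "measure Q (\<Inter>k. A k) = 0"
  proof -
    have "AE \<omega> in Q. \<omega> \<notin> (\<Inter>k. A k)"
      using ae
    proof eventually_elim
      case (elim \<omega>)
      then obtain t where t: "t \<in> U" "T \<omega> \<le> t" by blast
      obtain k where k: "from_nat_into U k = t"
        using from_nat_into_surj[OF cU t(1)] by blast
      have "t \<le> u k" unfolding u_def k[symmetric] by (intro Max_ge) auto
      then show ?case using t by (auto simp: A_def intro!: exI[of _ k])
    qed
    moreover have "(\<Inter>k. A k) \<in> sets Q" by (intro sets.countable_INT) (auto simp: A_def)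
    ultimately show ?thesis by (simp add: Q.prob_eq_0)
  qed
  ultimately have "(\<lambda>k. measure Q (A k)) \<longlonglongrightarrow> 0" by simp
  then have "eventually (\<lambda>k. measure Q (A k) < \<alpha>) sequentially"
    using \<alpha> by (rule order_tendstoD)
  then obtain k where "measure Q (A k) < \<alpha>" by (auto simp: eventually_sequentially)
  then show ?thesis using uU[of k] by (auto simp: A_def U_def)
qed

lemma sets_hierarchical_law:
  assumes "sets G = sets borel" "sets H = sets borel"
  shows "sets (hierarchical_law G H) = sets borel"
proof -
  have "sets (G \<Otimes>\<^sub>M H \<Otimes>\<^sub>M lborel) = sets (borel \<Otimes>\<^sub>M borel \<Otimes>\<^sub>M (borel :: real measure))"
    by (intro sets_pair_measure_cong assms sets_lborel)
  then show ?thesis unfolding hierarchical_law_def sets_density by (simp only: borel_prod)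
qed

lemma emeasure_hierarchical_law:
  assumes G: "real_distribution G" and H: "real_distribution H" and A: "A \<in> sets borel"
  shows "emeasure (hierarchical_law G H) A =
    (\<integral>\<^sup>+\<mu>. \<integral>\<^sup>+s. \<integral>\<^sup>+x. ennreal (normal_density \<mu> s x) * indicator A (\<mu>, s, x) \<partial>lborel \<partial>H \<partial>G)"
proof -
  interpret G: real_distribution G by fact
  interpret H: real_distribution H by fact
  interpret HL: pair_sigma_finite H lborel ..
  interpret GHL: pair_sigma_finite G "H \<Otimes>\<^sub>M lborel" ..
  have s: "sets (G \<Otimes>\<^sub>M H \<Otimes>\<^sub>M lborel) = sets (borel \<Otimes>\<^sub>M borel \<Otimes>\<^sub>M (borel :: real measure))"
    by (intro sets_pair_measure_cong G.events_eq_borel H.events_eq_borel sets_lborel)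
  then have A' [measurable]: "A \<in> sets (G \<Otimes>\<^sub>M H \<Otimes>\<^sub>M lborel)" using A by (simp only: borel_prod)
  have f [measurable]: "(\<lambda>(\<mu>, s, x). ennreal (normal_density \<mu> s x)) \<in> borel_measurable (G \<Otimes>\<^sub>M H \<Otimes>\<^sub>M lborel)"
    unfolding measurable_cong_sets[OF s refl] normal_density_def by measurable
  have "emeasure (hierarchical_law G H) A =
      (\<integral>\<^sup>+z. (\<lambda>(\<mu>, s, x). ennreal (normal_density \<mu> s x)) z * indicator A z \<partial>(G \<Otimes>\<^sub>M H \<Otimes>\<^sub>M lborel))"
    unfolding hierarchical_law_def by (rule emeasure_density) measurable
  also have "\<dots> = (\<integral>\<^sup>+\<mu>. \<integral>\<^sup>+y. (\<lambda>(\<mu>, s, x). ennreal (normal_density \<mu> s x)) (\<mu>, y) * indicator A (\<mu>, y) \<partial>(H \<Otimes>\<^sub>M lborel) \<partial>G)"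
    by (rule HL.P.nn_integral_fst[symmetric]) measurable
  also have "\<dots> = (\<integral>\<^sup>+\<mu>. \<integral>\<^sup>+s. \<integral>\<^sup>+x. ennreal (normal_density \<mu> s x) * indicator A (\<mu>, s, x) \<partial>lborel \<partial>H \<partial>G)"
  proof (rule nn_integral_cong)
    fix \<mu> assume \<mu>: "\<mu> \<in> space G"
    have "(\<lambda>y. (\<lambda>(\<mu>, s, x). ennreal (normal_density \<mu> s x)) (\<mu>, y) * indicator A (\<mu>, y)) \<in> borel_measurable (H \<Otimes>\<^sub>M lborel)"
      by (rule measurable_compose[OF measurable_Pair1'[OF \<mu>]]) measurable
    from lborel.nn_integral_fst[OF this]
    show "(\<integral>\<^sup>+y. (\<lambda>(\<mu>, s, x). ennreal (normal_density \<mu> s x)) (\<mu>, y) * indicator A (\<mu>, y) \<partial>(H \<Otimes>\<^sub>M lborel)) =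
      (\<integral>\<^sup>+s. \<integral>\<^sup>+x. ennreal (normal_density \<mu> s x) * indicator A (\<mu>, s, x) \<partial>lborel \<partial>H)" by simp
  qed
  finally show ?thesis .
qed

lemma AE_hierarchical_law_scale:
  assumes G: "real_distribution G" and H: "real_distribution H"
    and S: "S \<in> sets borel" "AE s in H. s \<in> S"
  shows "AE z in hierarchical_law G H. fst (snd z) \<in> S"
proof -
  interpret G: real_distribution G by fact
  interpret H: real_distribution H by fact
  define A where "A = {z :: real \<times> real \<times> real. fst (snd z) \<notin> S}"
  have A: "A \<in> sets borel"
  proof -
    have "(\<lambda>z. fst (snd z)) \<in> (borel :: (real \<times> real \<times> real) measure) \<rightarrow>\<^sub>M borel"
      unfolding borel_prod[symmetric] by measurable
    from measurable_sets[OF this, of "- S"] S(1) show ?thesis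
      by (simp add: A_def vimage_def)
  qed
  have "emeasure (hierarchical_law G H) A =
    (\<integral>\<^sup>+\<mu>. \<integral>\<^sup>+s. \<integral>\<^sup>+x. ennreal (normal_density \<mu> s x) * indicator A (\<mu>, s, x) \<partial>lborel \<partial>H \<partial>G)"
    by (rule emeasure_hierarchical_law[OF G H A])
  also have "\<dots> = (\<integral>\<^sup>+\<mu>. \<integral>\<^sup>+s. 0 \<partial>H \<partial>G)"
  proof (rule nn_integral_cong, rule nn_integral_cong_AE)
    fix \<mu>
    show "AE s in H. (\<integral>\<^sup>+x. ennreal (normal_density \<mu> s x) * indicator A (\<mu>, s, x) \<partial>lborel) = 0"
      using S(2) by eventually_elim (simp add: A_def)
  qed
  finally have "A \<in> null_sets (hierarchical_law G H)"
    using A by (auto simp: sets_hierarchical_law)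
  from AE_not_in[OF this] show ?thesis by eventually_elim (simp add: A_def)
qed

text \<open>For fixed mean and scale, the slice of \<open>A\<close> lies within distance
  \<open>d\<close> of any one of its points, hence in an interval of length 2 d, on which the
  density is at most 1 / c. The factor 2 comes from centering the interval at an arbitrary point of
  the slice.\<close>

lemma hierarchical_law_cell:
  assumes G: "real_distribution G" and H: "real_distribution H"
    and c: "0 < c" and A: "A \<in> sets borel" "\<And>\<mu> s x. (\<mu>, s, x) \<in> A \<Longrightarrow> c \<le> s"
    and d: "d \<ge> 0" "\<And>\<mu> s x y. (\<mu>, s, x) \<in> A \<Longrightarrow> (\<mu>, s, y) \<in> A \<Longrightarrow> \<bar>x - y\<bar> \<le> d"
  shows "measure (hierarchical_law G H) A \<le> 2 * d / c"
proof -
  interpret G: real_distribution G by fact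
  interpret H: real_distribution H by fact
  have "emeasure (hierarchical_law G H) A =
    (\<integral>\<^sup>+\<mu>. \<integral>\<^sup>+s. \<integral>\<^sup>+x. ennreal (normal_density \<mu> s x) * indicator A (\<mu>, s, x) \<partial>lborel \<partial>H \<partial>G)"
    by (rule emeasure_hierarchical_law[OF G H A(1)])
  also have "\<dots> \<le> (\<integral>\<^sup>+\<mu>. \<integral>\<^sup>+s. ennreal (2 * d / c) \<partial>H \<partial>G)"
  proof (intro nn_integral_mono)
    fix \<mu> s
    show "(\<integral>\<^sup>+x. ennreal (normal_density \<mu> s x) * indicator A (\<mu>, s, x) \<partial>lborel) \<le> ennreal (2 * d / c)"
    proof (cases "\<exists>x0. (\<mu>, s, x0) \<in> A")
      case True
      then obtain x0 where x0: "(\<mu>, s, x0) \<in> A" by blast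
      have s: "c \<le> s" using A(2)[OF x0] .
      have "(\<integral>\<^sup>+x. ennreal (normal_density \<mu> s x) * indicator A (\<mu>, s, x) \<partial>lborel) \<le>
          (\<integral>\<^sup>+x. ennreal (1 / c) * indicator {x0 - d..x0 + d} x \<partial>lborel)"
      proof (rule nn_integral_mono)
        fix x
        have "normal_density \<mu> s x \<le> 1 / c"
          using normal_density_bounds(1)[of s \<mu> x] s c by (smt (verit) frac_le)
        moreover have "x \<in> {x0 - d..x0 + d}" if "(\<mu>, s, x) \<in> A"
          using d(2)[OF that x0] by (auto simp: abs_le_iff)
        ultimately show "ennreal (normal_density \<mu> s x) * indicator A (\<mu>, s, x) \<le> ennreal (1 / c) * indicator {x0 - d..x0 + d} x"
          by (auto split: split_indicator intro: ennreal_leI)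
      qed
      also have "\<dots> = ennreal (1 / c) * ennreal (2 * d)"
        using d(1) by (subst nn_integral_cmult_indicator) auto
      also have "\<dots> = ennreal (2 * d / c)"
        using c d(1) by (simp add: ennreal_mult[symmetric])
      finally show ?thesis .
    qed simp
  qed
  also have "\<dots> = ennreal (2 * d / c)"
    using G.emeasure_space_1 H.emeasure_space_1 by simp
  finally show ?thesis
    unfolding measure_def using c d(1) by (metis divide_nonneg_pos enn2real_leI mult_nonneg_nonneg zero_le_numeral)
qed

subsection \<open>The regret\<close>

theorem theorem4:
  fixes \<M> :: "real measure set" and G\<^sub>0 H\<^sub>0 :: "real measure"
    and P :: "nat \<Rightarrow> 'w measure"
    and \<mu> \<sigma> X :: "nat \<Rightarrow> nat \<Rightarrow> 'w \<Rightarrow> real"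
    and Ghat :: "nat \<Rightarrow> (nat \<Rightarrow> real) \<times> (nat \<Rightarrow> real) \<Rightarrow> real measure"
    and G\<^sub>n :: "nat \<Rightarrow> 'w \<Rightarrow> real measure"
    and \<tau> \<tau>' :: "nat \<Rightarrow> 'w \<Rightarrow> nat \<Rightarrow> nat"
    and m :: "nat \<Rightarrow> nat" and \<alpha> :: real and r :: "nat \<Rightarrow> real"
  assumes family: "\<M> \<subseteq> nondegenerate_W1_distributions" and G0: "G\<^sub>0 \<in> \<M>"
    and H0: "real_distribution H\<^sub>0" "AE s in H\<^sub>0. s > 0"
    and prob: "\<And>n. n \<ge> 1 \<Longrightarrow> prob_space (P n)"
    and sample_indep: "\<And>n. n \<ge> 1 \<Longrightarrow>
      prob_space.indep_vars (P n) (\<lambda>_. borel) (\<lambda>i \<omega>. (\<mu> n i \<omega>, \<sigma> n i \<omega>, X n i \<omega>)) {1..n}"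
    and sample_law: "\<And>n i. n \<ge> 1 \<Longrightarrow> i \<in> {1..n} \<Longrightarrow>
      distr (P n) borel (\<lambda>\<omega>. (\<mu> n i \<omega>, \<sigma> n i \<omega>, X n i \<omega>)) = hierarchical_law G\<^sub>0 H\<^sub>0"
    and m_less: "\<And>n. n \<ge> 1 \<Longrightarrow> m n < n"
    and m_lim: "(\<lambda>n. real (m n) / real n) \<longlonglongrightarrow> \<alpha>" and \<alpha>: "0 < \<alpha>" "\<alpha> < 1"
    and estimator: "\<And>n. n \<ge> 1 \<Longrightarrow>
      Ghat n \<in> (\<Pi>\<^sub>M i\<in>{1..n}. borel) \<Otimes>\<^sub>M (\<Pi>\<^sub>M i\<in>{1..n}. borel) \<rightarrow>\<^sub>M W1_borel \<M>"
    and G\<^sub>n: "\<And>n \<omega>. G\<^sub>n n \<omega> = Ghat n (\<lambda>i\<in>{1..n}. X n i \<omega>, \<lambda>i\<in>{1..n}. \<sigma> n i \<omega>)"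
    and ties: "\<And>n. n \<ge> 1 \<Longrightarrow>
      random_permutation (P n) n (\<lambda>\<omega>. \<lambda>i\<in>{1..n}. (\<mu> n i \<omega>, \<sigma> n i \<omega>, X n i \<omega>)) (\<tau> n)"
    and ties': "\<And>n. n \<ge> 1 \<Longrightarrow>
      random_permutation (P n) n (\<lambda>\<omega>. \<lambda>i\<in>{1..n}. (\<mu> n i \<omega>, \<sigma> n i \<omega>, X n i \<omega>)) (\<tau>' n)"
    and rate: "\<And>n. n \<ge> 1 \<Longrightarrow> real n powr (- 1 / 2) \<le> r n" "r \<longlonglongrightarrow> 0"
    and W1_rate: "bigO_prob P (\<lambda>n \<omega>. W1 (G\<^sub>n n \<omega>) G\<^sub>0) r"
    and support: "compact (measure_support H\<^sub>0)" "\<exists>c>0. \<forall>s\<in>measure_support H\<^sub>0. c \<le> s"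
  shows "bigO_prob P
     (\<lambda>n \<omega>. regret n (m n)
        (\<lambda>i. posterior_mean G\<^sub>0 (\<sigma> n i \<omega>) (X n i \<omega>))
        (\<lambda>i. posterior_mean (G\<^sub>n n \<omega>) (\<sigma> n i \<omega>) (X n i \<omega>))
        (\<tau> n \<omega>) (\<tau>' n \<omega>))
     (\<lambda>n. (r n)\<^sup>2)"
proof -
  have prior: "G \<in> \<M> \<Longrightarrow> prior G" for G
    using family by (auto simp: nondegenerate_W1_distributions_iff)
  interpret G0: prior G\<^sub>0 by (rule prior[OF G0])
  interpret G0R: prior "distr G\<^sub>0 borel uminus" by (rule G0.prior_reflection)
  interpret H0: real_distribution H\<^sub>0 by fact
  define Q where "Q = hierarchical_law G\<^sub>0 H\<^sub>0"
  define T :: "real \<times> real \<times> real \<Rightarrow> real" where "T z = posterior_mean G\<^sub>0 (fst (snd z)) (snd (snd z))" for z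
  define Z where "Z n i \<omega> = (\<mu> n i \<omega>, \<sigma> n i \<omega>, X n i \<omega>)" for n i \<omega>
  have T_Z: "posterior_mean G\<^sub>0 (\<sigma> n i \<omega>) (X n i \<omega>) = T (Z n i \<omega>)" for n i \<omega>
    by (simp add: T_def Z_def)
  have indep: "prob_space.indep_vars (P n) (\<lambda>_. borel) (Z n) {1..n}" if "n \<ge> 1" for n
    using sample_indep[OF that] unfolding Z_def[abs_def] .
  have law: "distr (P n) borel (Z n i) = Q" if "n \<ge> 1" "i \<in> {1..n}" for n i
    using sample_law[OF that] by (simp add: Q_def Z_def[abs_def])
  have Z_meas: "Z n i \<in> P n \<rightarrow>\<^sub>M borel" if "n \<ge> 1" "i \<in> {1..n}" for n i
  proof -
    interpret prob_space "P n" by (rule prob[OF that(1)])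
    show ?thesis using indep[OF that(1)] that(2) by (simp add: indep_vars_def)
  qed
  have sets_Q: "sets Q = sets borel"
    unfolding Q_def by (rule sets_hierarchical_law) simp_all
  then have space_Q: "space Q = UNIV" using sets_eq_imp_space_eq[OF sets_Q] by simp
  \<comment> \<open>That \<open>Q\<close> has total mass 1 is read off from the sample of size 1,
    whose single triple has law \<open>Q\<close>.\<close>
  have Q_prob: "prob_space Q"
    using prob_space.prob_space_distr[OF prob[of 1] Z_meas[of 1 1]] law[of 1 1] by simp
  then interpret Q: prob_space Q .
  have snd_meas: "(\<lambda>z. fst (snd z)) \<in> (borel :: (real \<times> real \<times> real) measure) \<rightarrow>\<^sub>M borel"
      "(\<lambda>z. snd (snd z)) \<in> (borel :: (real \<times> real \<times> real) measure) \<rightarrow>\<^sub>M borel"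
    unfolding borel_prod[symmetric] by measurable
  have T_meas: "T \<in> borel_measurable borel"
    unfolding T_def[abs_def]
  proof (rule measurable_posterior_mean[OF _ snd_meas])
    show "(\<lambda>_. G\<^sub>0) \<in> borel \<rightarrow>\<^sub>M prob_algebra borel"
      by (rule measurable_const) (simp add: space_prob_algebra G0.prob_space_axioms)
  qed
  then have T_meas_Q: "T \<in> borel_measurable Q"
    using sets_Q by (simp cong: measurable_cong_sets)

  \<comment> \<open>Scale range, thresholds, cutoff and moduli\<close>
  obtain c where c: "c > 0" "\<And>s. s \<in> measure_support H\<^sub>0 \<Longrightarrow> c \<le> s"
    using support(2) by blast
  from compact_imp_bounded[OF support(1)] obtain C0 where C0: "\<And>s. s \<in> measure_support H\<^sub>0 \<Longrightarrow> \<bar>s\<bar> \<le> C0"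
    by (auto simp: bounded_iff)
  \<comment> \<open>The maximum yields \<open>c \<le> C\<close> without exhibiting a point of the
    support.\<close>
  define C where "C = max C0 c"
  have cC: "c \<le> C" by (simp add: C_def)
  have "AE s in H\<^sub>0. s \<in> {c..C}"
    using AE_measure_support[OF H0(1)]
  proof eventually_elim
    case (elim s)
    then show ?case using c(2)[OF elim] C0[OF elim] by (auto simp: C_def)
  qed
  then have scale: "AE z in Q. fst (snd z) \<in> {c..C}"
    unfolding Q_def by (intro AE_hierarchical_law_scale[OF G0.real_distribution_axioms H0(1)]) auto

  \<comment> \<open>Less than a fraction \<alpha> of the oracle values lies above \<open>t2\<close>,
    so the cut for the top \<open>m\<close> does not exceed \<open>t2\<close> with high probability,
    while the prior still has mass beyond \<open>b2 > t2\<close>.\<close>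
  obtain t2 b2 where t2: "t2 < b2" "G0.prob {b2<..} > 0" "Q.prob {z\<in>space Q. t2 < T z} < \<alpha>"
  proof -
    have "AE z in Q. G0.prob {T z<..} > 0"
      using scale
    proof eventually_elim
      case (elim z)
      then have "fst (snd z) > 0" using c by simp
      then show ?case unfolding T_def by (rule G0.prob_greater_posterior_mean[OF G0.nondegenerate])
    qed
    from exists_tail_level[OF Q_prob T_meas_Q G0.real_distribution_axioms this \<alpha>(1)] that show ?thesis by blast
  qed
  \<comment> \<open>The lower level is the upper one for the reflected prior and \<open>- T\<close>;
    the fraction 1 - \<alpha> is that of the indices not selected.\<close>
  obtain t1' b1 where t1': "t1' < b1" "G0R.prob {b1<..} > 0" "Q.prob {z\<in>space Q. t1' < - T z} < 1 - \<alpha>"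
  proof -
    have "AE z in Q. G0R.prob {- T z<..} > 0"
      using scale
    proof eventually_elim
      case (elim z)
      then have s: "fst (snd z) > 0" using c by simp
      from G0R.prob_greater_posterior_mean[OF G0R.nondegenerate s, of "- snd (snd z)"]
      show ?case unfolding T_def G0.posterior_mean_reflection[OF s] by simp
    qed
    moreover have "(\<lambda>z. - T z) \<in> borel_measurable Q" using T_meas_Q by simp
    ultimately show ?thesis
      using exists_tail_level[OF Q_prob _ G0R.real_distribution_axioms, of "\<lambda>z. - T z" "1 - \<alpha>"] \<alpha>(2) that by auto
  qed
  define t1 where "t1 = - t1'"
  have t1: "Q.prob {z\<in>space Q. T z < t1} < 1 - \<alpha>"
  proof -
    have "{z\<in>space Q. T z < t1} = {z\<in>space Q. t1' < - T z}" by (auto simp: t1_def)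
    then show ?thesis using t1'(3) by simp
  qed
  \<comment> \<open>Otherwise the two tail events would cover the space although their probabilities
    sum to less than \<alpha> + (1 - \<alpha>).\<close>
  have t12: "t1 \<le> t2"
  proof (rule ccontr)
    assume "\<not> t1 \<le> t2"
    then have "space Q \<subseteq> {z\<in>space Q. t2 < T z} \<union> {z\<in>space Q. T z < t1}" by auto
    then have "Q.prob (space Q) \<le> Q.prob ({z\<in>space Q. t2 < T z} \<union> {z\<in>space Q. T z < t1})"
      using T_meas_Q by (intro Q.finite_measure_mono) auto
    also have "\<dots> \<le> Q.prob {z\<in>space Q. t2 < T z} + Q.prob {z\<in>space Q. T z < t1}"
      using T_meas_Q by (intro measure_Un_le) auto
    finally show False using t1 t2(3) Q.prob_space by simp
  qed

  \<comment> \<open>The midpoint leaves room on both sides: below \<open>b2\<close>, so that the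
    posterior mean exceeds \<open>e2\<close> for large \<open>x\<close>, and above
    \<open>t2\<close>, so that the estimation error cannot carry a tail index across the threshold.
    \<open>e1\<close> mirrors this at the lower end.\<close>
  define e2 where "e2 = (t2 + b2) / 2"
  have e2: "t2 < e2" "e2 < b2" using t2(1) by (auto simp: e2_def)
  define e1 where "e1 = - ((t1' + b1) / 2)"
  have e1: "e1 < t1" "- e1 < b1" using t1'(1) by (auto simp: e1_def t1_def)
  obtain K2 where K2: "K2 \<ge> 0" "\<And>s x. c \<le> s \<Longrightarrow> s \<le> C \<Longrightarrow> K2 \<le> x \<Longrightarrow> e2 \<le> posterior_mean G\<^sub>0 s x"
    using G0.posterior_mean_exceeds[OF c(1) e2(2) t2(2), of C] by blast
  obtain K1 where K1: "K1 \<ge> 0" "\<And>s x. c \<le> s \<Longrightarrow> s \<le> C \<Longrightarrow> K1 \<le> x \<Longrightarrow> - e1 \<le> posterior_mean (distr G\<^sub>0 borel uminus) s x"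
    using G0R.posterior_mean_exceeds[OF c(1) e1(2) t1'(2), of C] by blast
  define K where "K = max K1 K2"
  have K0: "K \<ge> 0" using K1(1) by (simp add: K_def)
  have upK: "e2 \<le> posterior_mean G\<^sub>0 s x" if "c \<le> s" "s \<le> C" "K \<le> x" for s x
    using that by (intro K2) (auto simp: K_def)
  have downK: "posterior_mean G\<^sub>0 s x \<le> e1" if "c \<le> s" "s \<le> C" "x \<le> - K" for s x
  proof -
    have "s > 0" using that c by simp
    then show ?thesis
      using K1(2)[of s "- x"] that G0.posterior_mean_reflection[of s "- x"] by (simp add: K_def)
  qed
  obtain L \<delta> where L: "L > 0" "\<delta> > 0" "\<And>G' s x. moment_distribution G' \<Longrightarrow> W1 G' G\<^sub>0 \<le> \<delta> \<Longrightarrow> c \<le> s \<Longrightarrow> s \<le> C \<Longrightarrow>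
      \<bar>x\<bar> \<le> K \<Longrightarrow> \<bar>posterior_mean G' s x - posterior_mean G\<^sub>0 s x\<bar> \<le> L * W1 G' G\<^sub>0"
    using G0.posterior_mean_W1_lipschitz[OF c(1) cC K0] by metis
  obtain \<kappa> where \<kappa>: "\<kappa> > 0" "\<And>s x y. c \<le> s \<Longrightarrow> s \<le> C \<Longrightarrow> - K \<le> x \<Longrightarrow> x \<le> y \<Longrightarrow> y \<le> K \<Longrightarrow>
      \<kappa> * (y - x) \<le> posterior_mean G\<^sub>0 s y - posterior_mean G\<^sub>0 s x"
    using G0.posterior_mean_strict[OF c(1) cC K0] by metis
  obtain B where B: "B > 0" "\<And>s x. c \<le> s \<Longrightarrow> s \<le> C \<Longrightarrow> \<bar>x\<bar> \<le> K \<Longrightarrow> \<bar>posterior_mean G\<^sub>0 s x\<bar> \<le> B"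
    using G0.posterior_mean_bounded[OF c(1) cC, of K] by metis
  define \<epsilon>\<^sub>0 where "\<epsilon>\<^sub>0 = min (e2 - t2) (t1 - e1)"
  have \<epsilon>\<^sub>0: "\<epsilon>\<^sub>0 > 0" using e1 e2 by (simp add: \<epsilon>\<^sub>0_def)

  \<comment> \<open>Cells of oracle values and their probability\<close>
  define cell where "cell \<rho> k = {z. fst (snd z) \<in> {c..C} \<and> \<bar>snd (snd z)\<bar> \<le> K \<and> \<lfloor>T z / \<rho>\<rfloor> = k}" for \<rho> :: real and k :: int
  have cell_sets: "cell \<rho> k \<in> sets borel" for \<rho> k
  proof -
    note [measurable] = snd_meas T_meas
    have "{z\<in>space borel. fst (snd z) \<in> {c..C} \<and> \<bar>snd (snd z)\<bar> \<le> K \<and> \<lfloor>T z / \<rho>\<rfloor> = k} \<in> sets borel"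
      by measurable
    then show ?thesis by (simp add: cell_def)
  qed
  \<comment> \<open>Oracle values in a cell differ by at most \<rho>, so by the slope \<kappa> its
    slices at fixed mean and scale have diameter at most \<rho> / \<kappa>, and
    \<open>hierarchical_law_cell\<close> gives 2 (\<rho> / \<kappa>) / c. The cutoff and the scale
    range in \<open>cell\<close> are those on which the slope bound holds.\<close>
  define D where "D = 2 / (\<kappa> * c)"
  have D0: "D > 0" using \<kappa> c by (simp add: D_def)
  have cell_prob: "Q.prob (cell \<rho> k) \<le> D * \<rho>" if \<rho>: "\<rho> > 0" for \<rho> k
  proof -
    have "measure Q (cell \<rho> k) \<le> 2 * (\<rho> / \<kappa>) / c"
      unfolding Q_def
    proof (rule hierarchical_law_cell[OF G0.real_distribution_axioms H0(1) c(1) cell_sets])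
      show "\<rho> / \<kappa> \<ge> 0" using \<rho> \<kappa> by simp
      show "c \<le> s" if "(\<mu>, s, x) \<in> cell \<rho> k" for \<mu> s x using that by (simp add: cell_def)
      have gap: "y - x \<le> \<rho> / \<kappa>" if "x \<le> y" "(\<mu>, s, x) \<in> cell \<rho> k" "(\<mu>, s, y) \<in> cell \<rho> k" for \<mu> s x y
      proof -
        have sx: "c \<le> s" "s \<le> C" "- K \<le> x" "y \<le> K"
          and fl: "\<lfloor>posterior_mean G\<^sub>0 s x / \<rho>\<rfloor> = k" "\<lfloor>posterior_mean G\<^sub>0 s y / \<rho>\<rfloor> = k"
          using that by (auto simp: cell_def T_def)
        have "posterior_mean G\<^sub>0 s y / \<rho> - posterior_mean G\<^sub>0 s x / \<rho> \<le> 1" using fl by linarith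
        then have "posterior_mean G\<^sub>0 s y - posterior_mean G\<^sub>0 s x \<le> \<rho>" using \<rho> by (simp add: field_simps)
        with \<kappa>(2)[OF sx(1,2,3) that(1) sx(4)] have "\<kappa> * (y - x) \<le> \<rho>" by linarith
        then show ?thesis using \<kappa>(1) by (simp add: field_simps)
      qed
      show "\<bar>x - y\<bar> \<le> \<rho> / \<kappa>" if "(\<mu>, s, x) \<in> cell \<rho> k" "(\<mu>, s, y) \<in> cell \<rho> k" for \<mu> s x y
        using gap[OF _ that] gap[OF _ that(2,1)] by (cases "x \<le> y") (auto simp: abs_if)
    qed
    also have "\<dots> = D * \<rho>" by (simp add: D_def mult_ac)
    finally show ?thesis .
  qed

  \<comment> \<open>Measurability of the estimated prior and of the regret\<close>
  have Gn_M: "G\<^sub>n n \<omega> \<in> \<M>" and Gn_meas: "G\<^sub>n n \<in> P n \<rightarrow>\<^sub>M prob_algebra borel"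
    if n: "n \<ge> 1" and \<omega>: "\<omega> \<in> space (P n)" for n \<omega>
  proof -
    have XS: "(\<lambda>\<omega>. X n i \<omega>) \<in> borel_measurable (P n)" "(\<lambda>\<omega>. \<sigma> n i \<omega>) \<in> borel_measurable (P n)"
      if "i \<in> {1..n}" for i
      using measurable_compose[OF Z_meas[OF n that] snd_meas(1)] measurable_compose[OF Z_meas[OF n that] snd_meas(2)]
      by (simp_all add: Z_def)
    have "(\<lambda>\<omega>. (\<lambda>i\<in>{1..n}. X n i \<omega>, \<lambda>i\<in>{1..n}. \<sigma> n i \<omega>)) \<in> P n \<rightarrow>\<^sub>M (\<Pi>\<^sub>M i\<in>{1..n}. borel) \<Otimes>\<^sub>M (\<Pi>\<^sub>M i\<in>{1..n}. borel)"
      by (intro measurable_Pair measurable_restrict XS)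
    from measurable_compose[OF this estimator[OF n]] have *: "G\<^sub>n n \<in> P n \<rightarrow>\<^sub>M W1_borel \<M>"
      by (simp add: G\<^sub>n[abs_def])
    show "G\<^sub>n n \<omega> \<in> \<M>" using measurable_space[OF * \<omega>] by simp
    show "G\<^sub>n n \<in> P n \<rightarrow>\<^sub>M prob_algebra borel"
      using measurable_compose[OF * ident_measurable_W1_borel[OF family]] by simp
  qed
  have \<tau>_meas: "\<tau> n \<in> P n \<rightarrow>\<^sub>M count_space {p. p permutes {1..n}}" "\<tau>' n \<in> P n \<rightarrow>\<^sub>M count_space {p. p permutes {1..n}}"
    if "n \<ge> 1" for n
    using ties[OF that] ties'[OF that] by (simp_all add: random_permutation_def Let_def)

  define R where "R n \<omega> = regret n (m n)
        (\<lambda>i. posterior_mean G\<^sub>0 (\<sigma> n i \<omega>) (X n i \<omega>))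
        (\<lambda>i. posterior_mean (G\<^sub>n n \<omega>) (\<sigma> n i \<omega>) (X n i \<omega>))
        (\<tau> n \<omega>) (\<tau>' n \<omega>)" for n \<omega>
  have R_meas: "R n \<in> borel_measurable (P n)" if n: "n \<ge> 1" for n
  proof -
    interpret prob_space "P n" by (rule prob[OF n])
    obtain \<omega>\<^sub>0 where \<omega>\<^sub>0: "\<omega>\<^sub>0 \<in> space (P n)" using not_empty by blast
    have S: "\<sigma> n i \<in> borel_measurable (P n)" and Xm: "X n i \<in> borel_measurable (P n)" if "i \<in> {1..n}" for i
      using measurable_compose[OF Z_meas[OF n that] snd_meas(1)] measurable_compose[OF Z_meas[OF n that] snd_meas(2)]
      by (simp_all add: Z_def)
    show ?thesis unfolding R_def[abs_def]
    proof (rule measurable_regret[OF _ _ \<tau>_meas[OF n]])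
      fix i assume i: "i \<in> {1..n}"
      show "(\<lambda>\<omega>. posterior_mean G\<^sub>0 (\<sigma> n i \<omega>) (X n i \<omega>)) \<in> borel_measurable (P n)"
        unfolding T_Z by (rule measurable_compose[OF Z_meas[OF n i] T_meas])
      show "(\<lambda>\<omega>. posterior_mean (G\<^sub>n n \<omega>) (\<sigma> n i \<omega>) (X n i \<omega>)) \<in> borel_measurable (P n)"
        by (rule measurable_posterior_mean[OF Gn_meas[OF n \<omega>\<^sub>0] S[OF i] Xm[OF i]])
    qed
  qed

  have r_pos: "r n > 0" if "n \<ge> 1" for n
    by (rule less_le_trans[OF _ rate(1)[OF that]]) (use that in simp)
  \<comment> \<open>This is where r \<ge> n^(-1/2) matters: a fluctuation of order sqrt n in a cell
    count is no larger than the order n r of its mean bound.\<close>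
  have r_sqrt: "sqrt (real n) \<le> real n * r n" if "n \<ge> 1" for n
  proof -
    have "real n powr (- 1 / 2) = 1 / sqrt (real n)"
      using that by (simp add: powr_minus powr_half_sqrt inverse_eq_divide)
    with rate(1)[OF that] have "1 / sqrt (real n) \<le> r n" by simp
    then have "real n * (1 / sqrt (real n)) \<le> real n * r n" by (intro mult_left_mono) auto
    then show ?thesis by (simp add: real_div_sqrt)
  qed

  \<comment> \<open>A deterministic bound on the good event\<close>
  define low where "low n \<omega> = real (card {i\<in>{1..n}. Z n i \<omega> \<in> {z. T z < t1}})" for n \<omega>
  define high where "high n \<omega> = real (card {i\<in>{1..n}. Z n i \<omega> \<in> {z. t2 < T z}})" for n \<omega>
  define count where "count n k \<omega> = real (card {i\<in>{1..n}. Z n i \<omega> \<in> cell (r n) k})" for n k \<omega>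
  \<comment> \<open>The cells that can contain an oracle value in [-B, B]. Their number grows as
    \<open>r n\<close> tends to 0, which is harmless because the squared deviations are controlled
    in sum.\<close>
  define F where "F n = {\<lfloor>- B / r n\<rfloor>..\<lfloor>B / r n\<rfloor>}" for n

  \<comment> \<open>All randomness is confined to the premises: the size of the estimation error,
    the scale range, the two tail counts and the cell counts. \<open>A\<close> and \<open>a\<close>
    stay free until a probability level is given.\<close>
  have good: "\<bar>R n \<omega>\<bar> \<le> (2 * L * A) * (2 * L * A + 2) * (D + sqrt a) * (r n)\<^sup>2"
    if n: "n \<ge> 1" and \<omega>: "\<omega> \<in> space (P n)" and A: "W1 (G\<^sub>n n \<omega>) G\<^sub>0 \<le> A * r n" "A * r n \<le> \<delta>" "L * (A * r n) < \<epsilon>\<^sub>0 / 2" "A \<ge> 0"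
      and sc: "\<forall>i\<in>{1..n}. \<sigma> n i \<omega> \<in> {c..C}"
      and lo: "low n \<omega> \<le> real n - real (m n)" and hi: "high n \<omega> < real (m n)"
      and ct: "\<And>k. k \<in> F n \<Longrightarrow> (count n k \<omega> - real n * Q.prob (cell (r n) k))\<^sup>2 \<le> real n * a" and a: "a \<ge> 0"
    for n \<omega> A a
  proof -
    interpret G': prior "G\<^sub>n n \<omega>" by (rule prior[OF Gn_M[OF n \<omega>]])
    define \<theta> where "\<theta> i = posterior_mean G\<^sub>0 (\<sigma> n i \<omega>) (X n i \<omega>)" for i
    define \<theta>' where "\<theta>' i = posterior_mean (G\<^sub>n n \<omega>) (\<sigma> n i \<omega>) (X n i \<omega>)" for i
    define \<eta> where "\<eta> = L * (A * r n)"
    define I where "I = {i\<in>{1..n}. \<bar>X n i \<omega>\<bar> \<le> K}"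
    have r: "r n > 0" by (rule r_pos[OF n])
    have \<eta>0: "\<eta> \<ge> 0" using L(1) A(4) r by (simp add: \<eta>_def)
    \<comment> \<open>Half of each gap, because \<eta> is spent twice: on the tail index, whose
      estimate is controlled through its value at the cutoff, and on the index inside
      \<open>I\<close> that it is compared with.\<close>
    have \<eta>2: "\<eta> < (e2 - t2) / 2" "\<eta> < (t1 - e1) / 2" using A(3) by (auto simp: \<eta>_def \<epsilon>\<^sub>0_def)
    have s: "c \<le> \<sigma> n i \<omega>" "\<sigma> n i \<omega> \<le> C" "\<sigma> n i \<omega> > 0" if "i \<in> {1..n}" for i
      using sc that c(1) by force+
    have close: "\<bar>posterior_mean (G\<^sub>n n \<omega>) (\<sigma> n i \<omega>) x - posterior_mean G\<^sub>0 (\<sigma> n i \<omega>) x\<bar> \<le> \<eta>"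
      if i: "i \<in> {1..n}" and x: "\<bar>x\<bar> \<le> K" for i x
    proof -
      have "L * W1 (G\<^sub>n n \<omega>) G\<^sub>0 \<le> \<eta>" unfolding \<eta>_def using A(1) L(1) by (intro mult_left_mono) auto
      moreover have "W1 (G\<^sub>n n \<omega>) G\<^sub>0 \<le> \<delta>" using A(1,2) by linarith
      ultimately show ?thesis
        using L(3)[OF G'.moment_distribution_axioms _ s(1,2)[OF i] x] by linarith
    qed
    \<comment> \<open>No closeness is available at \<open>X n i \<omega>\<close> itself. The
      estimate is compared with its own value at \<open>K\<close> by monotonicity, and only there
      with the oracle.\<close>
    have upper: "e2 \<le> \<theta> i" "e2 - \<eta> \<le> \<theta>' i" if i: "i \<in> {1..n}" "K \<le> X n i \<omega>" for i
    proof -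
      show "e2 \<le> \<theta> i" unfolding \<theta>_def using upK[OF s(1,2)[OF i(1)] i(2)] .
      have "e2 \<le> posterior_mean G\<^sub>0 (\<sigma> n i \<omega>) K" using upK[OF s(1,2)[OF i(1)]] by simp
      moreover have "posterior_mean (G\<^sub>n n \<omega>) (\<sigma> n i \<omega>) K \<le> \<theta>' i"
        unfolding \<theta>'_def by (rule G'.posterior_mean_mono[OF s(3)[OF i(1)] i(2)])
      ultimately show "e2 - \<eta> \<le> \<theta>' i" using close[OF i(1), of K] K0 by (simp add: abs_le_iff)
    qed
    have lower: "\<theta> i \<le> e1" "\<theta>' i \<le> e1 + \<eta>" if i: "i \<in> {1..n}" "X n i \<omega> \<le> - K" for i
    proof -
      show "\<theta> i \<le> e1" unfolding \<theta>_def using downK[OF s(1,2)[OF i(1)] i(2)] .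
      have "posterior_mean G\<^sub>0 (\<sigma> n i \<omega>) (- K) \<le> e1" using downK[OF s(1,2)[OF i(1)]] by simp
      moreover have "\<theta>' i \<le> posterior_mean (G\<^sub>n n \<omega>) (\<sigma> n i \<omega>) (- K)"
        unfolding \<theta>'_def by (rule G'.posterior_mean_mono[OF s(3)[OF i(1)] i(2)])
      ultimately show "\<theta>' i \<le> e1 + \<eta>" using close[OF i(1), of "- K"] K0 by (simp add: abs_le_iff)
    qed
    have mid: "\<bar>\<theta>' i - \<theta> i\<bar> \<le> \<eta>" if "i \<in> I" for i
      using close[of i] that by (auto simp: I_def \<theta>_def \<theta>'_def)
    have cases: "i \<in> I \<or> X n i \<omega> \<le> - K \<or> K \<le> X n i \<omega>" if "i \<in> {1..n}" for i
      using that by (auto simp: I_def abs_le_iff)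
    \<comment> \<open>Inside \<open>I\<close> the error costs one further \<eta>, and
      \<open>e2 - 2 * \<eta> > t2\<close>. An index in the lower tail is ruled out by the chain e1 +
      \<eta> < t1 \<le> t2 < e2 - \<eta>. The companion \<open>below\<close> is symmetric.\<close>
    have above: "t2 < \<theta> j" if j: "j \<in> {1..n}" "e2 - \<eta> \<le> \<theta>' j" for j
    proof -
      consider "j \<in> I" | "X n j \<omega> \<le> - K" | "K \<le> X n j \<omega>" using cases[OF j(1)] by blast
      then show ?thesis
      proof cases
        case 1 then show ?thesis using mid[of j] j(2) \<eta>2 by (auto simp: abs_le_iff)
      next
        case 2
        have "e2 - \<eta> \<le> e1 + \<eta>" using lower(2)[OF j(1) 2] j(2) by linarith
        then show ?thesis using \<eta>2 \<eta>0 t12 by argo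
      next
        case 3 then show ?thesis using upper(1)[OF j(1)] e2 by linarith
      qed
    qed
    have below: "e1 + \<eta> < \<theta>' j" if j: "j \<in> {1..n}" "t1 \<le> \<theta> j" for j
    proof -
      consider "j \<in> I" | "X n j \<omega> \<le> - K" | "K \<le> X n j \<omega>" using cases[OF j(1)] by blast
      then show ?thesis
      proof cases
        case 1
        then have "\<theta> j - \<eta> \<le> \<theta>' j" using mid[of j] by (auto simp: abs_le_iff)
        then show ?thesis using j(2) \<eta>2 by argo
      next
        case 2
        then show ?thesis using lower(1)[OF j(1)] j(2) e1 by linarith
      next
        case 3
        show ?thesis using upper(2)[OF j(1) 3] \<eta>2 \<eta>0 t12 by argo
      qed
    qed
    have perm: "\<tau> n \<omega> permutes {1..n}" "\<tau>' n \<omega> permutes {1..n}"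
      using measurable_space[OF \<tau>_meas(1)[OF n] \<omega>] measurable_space[OF \<tau>_meas(2)[OF n] \<omega>] by simp_all
    have m: "m n \<le> n" using m_less[OF n] by simp
    have \<theta>_T: "T (Z n i \<omega>) = \<theta> i" for i by (simp add: \<theta>_def T_Z)
    have card_low: "m n \<le> card {j\<in>{1..n}. t1 \<le> \<theta> j}"
    proof -
      define S where "S = {j\<in>{1..n}. \<theta> j < t1}"
      have "S \<subseteq> {1..n}" by (auto simp: S_def)
      then have "card ({1..n} - S) = n - card S"
        using card_Diff_subset[OF finite_subset[OF _ finite_atLeastAtMost]] by (metis card_atLeastAtMost diff_Suc_1)
      moreover have "{j\<in>{1..n}. t1 \<le> \<theta> j} = {1..n} - S" by (auto simp: S_def)
      ultimately have "card {j\<in>{1..n}. t1 \<le> \<theta> j} = n - card S" by (simp only:)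
      moreover have "real (card S) \<le> real n - real (m n)"
        using lo by (simp add: low_def \<theta>_T S_def)
      ultimately show ?thesis using m by linarith
    qed
    have card_high: "card {j\<in>{1..n}. t2 < \<theta> j} < m n"
      using hi by (simp add: high_def \<theta>_T)
    obtain u where u: "\<bar>regret n (m n) \<theta> \<theta>' (\<tau> n \<omega>) (\<tau>' n \<omega>)\<bar> \<le>
      2 * \<eta> / real n * real (card {i\<in>{1..n} \<inter> I. u \<le> \<theta> i \<and> \<theta> i \<le> u + 2 * \<eta>})"
    proof (atomize_elim, rule regret_window[OF m perm mid \<eta>0 card_low card_high])
      fix i assume i: "i \<in> {1..n} - I"
      then have i': "i \<in> {1..n}" by simp
      from cases[OF i'] i consider "X n i \<omega> \<le> - K" | "K \<le> X n i \<omega>" by blast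
      then show "t2 < \<theta> i \<and> {j\<in>{1..n}. \<theta>' i \<le> \<theta>' j} \<subseteq> {j\<in>{1..n}. t2 < \<theta> j} \<or>
          \<theta> i < t1 \<and> (\<forall>j\<in>{1..n}. t1 \<le> \<theta> j \<longrightarrow> \<theta>' i < \<theta>' j)"
      proof cases
        case 1
        have "\<theta>' i < \<theta>' j" if "j \<in> {1..n}" "t1 \<le> \<theta> j" for j
          using lower(2)[OF i' 1] below[OF that] by linarith
        moreover have "\<theta> i < t1" using lower(1)[OF i' 1] e1 by linarith
        ultimately show ?thesis by blast
      next
        case 2
        have "t2 < \<theta> j" if "j \<in> {1..n}" "\<theta>' i \<le> \<theta>' j" for j
          using upper(2)[OF i' 2] above[OF that(1)] that(2) by linarith
        moreover have "t2 < \<theta> i" using upper(1)[OF i' 2] e2 by linarith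
        ultimately show ?thesis by blast
      qed
    qed
    define b where "b = real n * r n * (D + sqrt a)"
    have b0: "b \<ge> 0" using D0 a r by (simp add: b_def)
    \<comment> \<open>Each cell holds at most \<open>b\<close> indices: the mean is at most n D r,
      and the deviation is at most sqrt (n a) \<le> n r sqrt a. Cells outside \<open>F n\<close> are
      empty, since the oracle values of indices in \<open>I\<close> are bounded by
      \<open>B\<close>.\<close>
    have window: "real (card {i\<in>{1..n} \<inter> I. u \<le> \<theta> i \<and> \<theta> i \<le> u + 2 * \<eta>}) \<le> (2 * \<eta> / r n + 2) * b"
    proof (rule card_window_le_cells[OF _ r _ b0])
      fix k
      have eq: "{i\<in>{1..n} \<inter> I. \<lfloor>\<theta> i / r n\<rfloor> = k} = {i\<in>{1..n}. Z n i \<omega> \<in> cell (r n) k}"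
        using sc by (auto simp: cell_def \<theta>_T) (auto simp: I_def Z_def)
      show "real (card {i\<in>{1..n} \<inter> I. \<lfloor>\<theta> i / r n\<rfloor> = k}) \<le> b"
      proof (cases "k \<in> F n")
        case True
        have "count n k \<omega> - real n * Q.prob (cell (r n) k) \<le> sqrt (real n * a)"
          using ct[OF True] by (rule real_le_rsqrt)
        also have "\<dots> \<le> real n * r n * sqrt a"
          unfolding real_sqrt_mult using r_sqrt[OF n] a by (intro mult_right_mono) auto
        finally have "count n k \<omega> \<le> real n * Q.prob (cell (r n) k) + real n * r n * sqrt a" by simp
        also have "real n * Q.prob (cell (r n) k) \<le> real n * (D * r n)"
          using cell_prob[OF r] by (intro mult_left_mono) auto
        finally show ?thesis unfolding eq count_def b_def by (simp add: algebra_simps)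
      next
        case False
        have "k \<in> F n" if "i \<in> {1..n} \<inter> I" "\<lfloor>\<theta> i / r n\<rfloor> = k" for i
        proof -
          have i: "i \<in> {1..n}" "\<bar>X n i \<omega>\<bar> \<le> K" using that(1) unfolding I_def by blast+
          then have "\<bar>\<theta> i\<bar> \<le> B" unfolding \<theta>_def using s(1,2) by (intro B) auto
          then have "- B / r n \<le> \<theta> i / r n" "\<theta> i / r n \<le> B / r n"
            using r by (intro divide_right_mono; simp add: abs_le_iff)+
          then have "\<lfloor>\<theta> i / r n\<rfloor> \<in> F n" unfolding F_def by (simp only: atLeastAtMost_iff floor_mono simp_thms)
          then show ?thesis using that(2) by simp
        qed
        with False have "{i\<in>{1..n} \<inter> I. \<lfloor>\<theta> i / r n\<rfloor> = k} = {}" by blast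
        then show ?thesis using b0 by (simp only: card.empty of_nat_0)
      qed
    qed (use \<eta>0 in auto)
    have "\<bar>R n \<omega>\<bar> \<le> 2 * \<eta> / real n * ((2 * \<eta> / r n + 2) * b)"
    proof -
      have "R n \<omega> = regret n (m n) \<theta> \<theta>' (\<tau> n \<omega>) (\<tau>' n \<omega>)"
        by (simp add: R_def \<theta>_def[abs_def] \<theta>'_def[abs_def])
      moreover have "2 * \<eta> / real n * real (card {i\<in>{1..n} \<inter> I. u \<le> \<theta> i \<and> \<theta> i \<le> u + 2 * \<eta>}) \<le>
          2 * \<eta> / real n * ((2 * \<eta> / r n + 2) * b)"
        using window \<eta>0 by (intro mult_left_mono) auto
      ultimately show ?thesis using u by linarith
    qed
    \<comment> \<open>One factor \<open>r n\<close> comes from \<eta> = L A r, the other from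
      \<open>b / n\<close>; the number 2 \<eta> / r + 2 of cells is constant.\<close>
    also have "\<dots> = (2 * L * A) * (2 * L * A + 2) * (D + sqrt a) * (r n)\<^sup>2"
      using n r by (simp add: \<eta>_def b_def power2_eq_square)
    finally show ?thesis .
  qed

  \<comment> \<open>Probability of the bad events\<close>
  show ?thesis
    unfolding bigO_prob_def R_def[symmetric]
  proof (intro conjI allI impI)
    show "R n \<in> borel_measurable (P n)" if "n \<ge> 1" for n by (rule R_meas[OF that])
  next
    fix \<epsilon> :: real assume \<epsilon>: "\<epsilon> > 0"
    show "\<exists>M N. \<forall>n>N. measure (P n) {\<omega>\<in>space (P n). \<bar>R n \<omega> / (r n)\<^sup>2\<bar> > M} < \<epsilon>"
    proof -
      obtain M0 N0 where M0: "\<And>n. n > N0 \<Longrightarrow> measure (P n) {\<omega>\<in>space (P n). \<bar>W1 (G\<^sub>n n \<omega>) G\<^sub>0 / r n\<bar> > M0} < \<epsilon> / 4"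
        using W1_rate \<epsilon> unfolding bigO_prob_def by (meson divide_pos_pos zero_less_numeral)
      \<comment> \<open>The constant \<open>M0\<close> from boundedness in probability may be
        negative, whereas \<open>good\<close> asks for \<open>A \<ge> 0\<close>.\<close>
      define A where "A = max M0 0"
      \<comment> \<open>Each of the four bad events gets a share below \<epsilon> / 4; the cell
        counts exceed their level with probability at most 1 / a = \<epsilon> / 8.\<close>
      define a where "a = 8 / \<epsilon>"
      have a0: "a > 0" using \<epsilon> by (simp add: a_def)
      have a1: "1 / a < \<epsilon> / 4" using \<epsilon> by (simp add: a_def)
      define p1 where "p1 = Q.prob {z. T z < t1}"
      define p2 where "p2 = Q.prob {z. t2 < T z}"
      have p: "p1 < 1 - \<alpha>" "p2 < \<alpha>" using t1 t2(3) by (auto simp: p1_def p2_def space_Q)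
      \<comment> \<open>Half of the slack: \<open>p2 + g2\<close> is still below \<alpha> and
        \<open>1 - p1 - g1\<close> still above it, so for large \<open>n\<close> the ratio m / n
        lies strictly between them and tail counts within n g of their means are on the right side
        of \<open>m\<close>.\<close>
      define g1 where "g1 = (1 - \<alpha> - p1) / 2"
      define g2 where "g2 = (\<alpha> - p2) / 2"
      have g: "g1 > 0" "g2 > 0" using p by (auto simp: g1_def g2_def)
      have "eventually (\<lambda>n. A * r n < \<delta>) sequentially"
        by (rule order_tendstoD(2)[OF tendsto_mult_left[OF rate(2)]]) (use L(2) in simp)
      moreover have "eventually (\<lambda>n. L * (A * r n) < \<epsilon>\<^sub>0 / 2) sequentially"
        by (rule order_tendstoD(2)[OF tendsto_mult_left[OF tendsto_mult_left[OF rate(2)]]]) (use \<epsilon>\<^sub>0 in simp)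
      moreover have "eventually (\<lambda>n. p2 + g2 < real (m n) / real n) sequentially"
        by (rule order_tendstoD(1)[OF m_lim]) (use p in \<open>simp add: g2_def field_simps\<close>)
      moreover have "eventually (\<lambda>n. real (m n) / real n < 1 - p1 - g1) sequentially"
        by (rule order_tendstoD(2)[OF m_lim]) (use p in \<open>simp add: g1_def field_simps\<close>)
      moreover have "eventually (\<lambda>n. real n > a / g1\<^sup>2) sequentially" "eventually (\<lambda>n. real n > a / g2\<^sup>2) sequentially"
        by (rule filterlim_at_top_dense[THEN iffD1, rule_format, OF filterlim_real_sequentially])+
      ultimately have "eventually (\<lambda>n. A * r n < \<delta> \<and> L * (A * r n) < \<epsilon>\<^sub>0 / 2 \<and> p2 + g2 < real (m n) / real n \<and>
          real (m n) / real n < 1 - p1 - g1 \<and> real n > a / g1\<^sup>2 \<and> real n > a / g2\<^sup>2) sequentially"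
        by eventually_elim simp
      then obtain N1 where N1: "\<And>n. n \<ge> N1 \<Longrightarrow> A * r n < \<delta> \<and> L * (A * r n) < \<epsilon>\<^sub>0 / 2 \<and> p2 + g2 < real (m n) / real n \<and>
          real (m n) / real n < 1 - p1 - g1 \<and> real n > a / g1\<^sup>2 \<and> real n > a / g2\<^sup>2"
        by (auto simp: eventually_sequentially)
      define M where "M = (2 * L * A) * (2 * L * A + 2) * (D + sqrt a)"
      have "measure (P n) {\<omega>\<in>space (P n). \<bar>R n \<omega> / (r n)\<^sup>2\<bar> > M} < \<epsilon>" if "n > max N0 N1" for n
      proof -
        have n: "n \<ge> 1" "n > N0" "n \<ge> N1" using that by auto
        interpret prob_space "P n" by (rule prob[OF n(1)])
        have r: "r n > 0" by (rule r_pos[OF n(1)])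
        have n0: "0 < real n" using n(1) by simp
        note N = N1[OF n(3)]
        define B1 where "B1 = {\<omega>\<in>space (P n). \<bar>W1 (G\<^sub>n n \<omega>) G\<^sub>0 / r n\<bar> > M0}"
        define U where "U FF AA \<omega> = (\<Sum>k\<in>FF. (real (card {i\<in>{1..n}. Z n i \<omega> \<in> AA k}) - real n * Q.prob (AA k))\<^sup>2)"
          for FF :: "int set" and AA \<omega>
        define B2 where "B2 = {\<omega>\<in>space (P n). U (F n) (cell (r n)) \<omega> \<ge> real n * a}"
        \<comment> \<open>With a single cell the concentration bound is Chebyshev's inequality. The
          level (n g)^2 is written as n times (n g^2) to fit its form, so the probability is at most
          1 / (n g^2) and tends to 0.\<close>
        define B3 where "B3 = {\<omega>\<in>space (P n). U {0} (\<lambda>_. {z. T z < t1}) \<omega> \<ge> real n * (real n * g1\<^sup>2)}"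
        define B4 where "B4 = {\<omega>\<in>space (P n). U {0} (\<lambda>_. {z. t2 < T z}) \<omega> \<ge> real n * (real n * g2\<^sup>2)}"
        have conc: "{\<omega>\<in>space (P n). U FF AA \<omega> \<ge> real n * a'} \<in> events"
          "prob {\<omega>\<in>space (P n). U FF AA \<omega> \<ge> real n * a'} \<le> 1 / a'"
          if "finite FF" "\<And>k. k \<in> FF \<Longrightarrow> AA k \<in> sets borel" "disjoint_family_on AA FF" "a' > 0" for FF AA a'
        proof -
          have ne: "{1..n} \<noteq> {}" and cn: "card {1..n} = n" using n(1) by auto
          note * = cell_counts_concentrate[OF finite_atLeastAtMost ne indep[OF n(1)] law[OF n(1)] that, unfolded cn]
          show "{\<omega>\<in>space (P n). U FF AA \<omega> \<ge> real n * a'} \<in> events"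
            unfolding U_def by (rule *(1))
          show "prob {\<omega>\<in>space (P n). U FF AA \<omega> \<ge> real n * a'} \<le> 1 / a'"
            unfolding U_def by (rule *(2))
        qed
        have Tsets: "{z. T z < t1} \<in> sets borel" "{z. t2 < T z} \<in> sets borel"
        proof -
          note [measurable] = T_meas
          have "{z\<in>space borel. T z < t1} \<in> sets borel" "{z\<in>space borel. t2 < T z} \<in> sets borel"
            by measurable
          then show "{z. T z < t1} \<in> sets borel" "{z. t2 < T z} \<in> sets borel" by simp_all
        qed
        have ev1: "B1 \<in> events"
        proof -
          have "(\<lambda>\<omega>. W1 (G\<^sub>n n \<omega>) G\<^sub>0) \<in> borel_measurable (P n)"
            using W1_rate n(1) by (auto simp: bigO_prob_def)
          then show ?thesis unfolding B1_def by measurable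
        qed
        have ev2: "B2 \<in> events" and pr2: "prob B2 \<le> 1 / a"
        proof -
          have "finite (F n)" "disjoint_family_on (cell (r n)) (F n)"
            by (auto simp: F_def disjoint_family_on_def cell_def)
          note * = conc[OF this(1) cell_sets this(2) a0]
          show "B2 \<in> events" "prob B2 \<le> 1 / a" unfolding B2_def using * by blast+
        qed
        have gn: "0 < real n * g1\<^sup>2" "0 < real n * g2\<^sup>2" using g n(1) by auto
        have ev3: "B3 \<in> events" and pr3: "prob B3 \<le> 1 / (real n * g1\<^sup>2)"
          and ev4: "B4 \<in> events" and pr4: "prob B4 \<le> 1 / (real n * g2\<^sup>2)"
        proof -
          have dis: "disjoint_family_on A {0::int}" for A :: "int \<Rightarrow> (real \<times> real \<times> real) set"
            by (simp add: disjoint_family_on_def)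
          note * = conc[OF _ Tsets(1) dis gn(1)] conc[OF _ Tsets(2) dis gn(2)]
          show "B3 \<in> events" "prob B3 \<le> 1 / (real n * g1\<^sup>2)" "B4 \<in> events" "prob B4 \<le> 1 / (real n * g2\<^sup>2)"
            unfolding B3_def B4_def using * by blast+
        qed
        have small: "1 / (real n * g1\<^sup>2) < \<epsilon> / 4" "1 / (real n * g2\<^sup>2) < \<epsilon> / 4"
        proof -
          have "1 / (real n * h\<^sup>2) < \<epsilon> / 4" if h: "h > 0" "a / h\<^sup>2 < real n" for h
          proof -
            have "a < real n * h\<^sup>2" using h by (simp add: field_simps)
            then have "1 / (real n * h\<^sup>2) \<le> 1 / a" using a0 by (intro frac_le) auto
            then show ?thesis using a1 by linarith
          qed
          then show "1 / (real n * g1\<^sup>2) < \<epsilon> / 4" "1 / (real n * g2\<^sup>2) < \<epsilon> / 4" using g N by auto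
        qed
        have pr1: "prob B1 < \<epsilon> / 4" unfolding B1_def by (rule M0[OF n(2)])
        have "prob (B1 \<union> B2 \<union> B3 \<union> B4) \<le> prob B1 + prob B2 + prob B3 + prob B4"
        proof -
          have "prob (B1 \<union> B2 \<union> B3 \<union> B4) \<le> prob (B1 \<union> B2 \<union> B3) + prob B4"
            by (intro measure_Un_le sets.Un ev1 ev2 ev3 ev4)
          also have "prob (B1 \<union> B2 \<union> B3) \<le> prob (B1 \<union> B2) + prob B3"
            by (intro measure_Un_le sets.Un ev1 ev2 ev3 ev4)
          also have "prob (B1 \<union> B2) \<le> prob B1 + prob B2"
            by (intro measure_Un_le sets.Un ev1 ev2 ev3 ev4)
          finally show ?thesis by simp
        qed
        moreover have "prob {\<omega>\<in>space (P n). \<bar>R n \<omega> / (r n)\<^sup>2\<bar> > M} \<le> prob (B1 \<union> B2 \<union> B3 \<union> B4)"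
        \<comment> \<open>The inclusion in the four bad events holds only where all scales lie in
          [c, C], which is almost sure, so the probabilities are compared up to a null set.\<close>
        proof (rule finite_measure_mono_AE)
          show "B1 \<union> B2 \<union> B3 \<union> B4 \<in> events" by (intro sets.Un ev1 ev2 ev3 ev4)
          have "AE \<omega> in P n. \<forall>i\<in>{1..n}. \<sigma> n i \<omega> \<in> {c..C}"
          proof (rule AE_finite_allI)
            fix i assume i: "i \<in> {1..n}"
            have "AE z in distr (P n) borel (Z n i). fst (snd z) \<in> {c..C}" using scale unfolding law[OF n(1) i] .
            from AE_distrD[OF Z_meas[OF n(1) i] this] show "AE \<omega> in P n. \<sigma> n i \<omega> \<in> {c..C}"
              by (simp only: Z_def fst_conv snd_conv)
          qed simp
          with AE_space show "AE \<omega> in P n. \<omega> \<in> {\<omega>\<in>space (P n). \<bar>R n \<omega> / (r n)\<^sup>2\<bar> > M} \<longrightarrow> \<omega> \<in> B1 \<union> B2 \<union> B3 \<union> B4"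
          proof eventually_elim
            case (elim \<omega>)
            show ?case
            proof (rule impI, rule ccontr)
              assume bad: "\<omega> \<in> {\<omega>\<in>space (P n). \<bar>R n \<omega> / (r n)\<^sup>2\<bar> > M}" and nB: "\<omega> \<notin> B1 \<union> B2 \<union> B3 \<union> B4"
              have "\<bar>W1 (G\<^sub>n n \<omega>) G\<^sub>0 / r n\<bar> \<le> A" using nB elim(1) by (auto simp: B1_def A_def)
              then have W: "W1 (G\<^sub>n n \<omega>) G\<^sub>0 \<le> A * r n" using r by (simp add: abs_le_iff field_simps)
              have lo: "low n \<omega> \<le> real n - real (m n)"
              proof -
                \<comment> \<open>Outside \<open>B3\<close> the deviation is below n g1 in absolute
                  value; only the upper side of it is used.\<close>
                have "(low n \<omega> - real n * p1)\<^sup>2 < (real n * g1)\<^sup>2"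
                  using nB elim(1) by (auto simp: B3_def U_def low_def p1_def power2_eq_square mult_ac)
                then have "low n \<omega> - real n * p1 < real n * g1"
                  by (rule power2_less_imp_less) (use g n0 in simp)
                moreover have "real (m n) < (1 - p1 - g1) * real n"
                  using N by (intro pos_divide_less_eq[OF n0, THEN iffD1]) blast
                ultimately show ?thesis by (simp add: algebra_simps)
              qed
              have hi: "high n \<omega> < real (m n)"
              proof -
                have "(high n \<omega> - real n * p2)\<^sup>2 < (real n * g2)\<^sup>2"
                  using nB elim(1) by (auto simp: B4_def U_def high_def p2_def power2_eq_square mult_ac)
                then have "high n \<omega> - real n * p2 < real n * g2"
                  by (rule power2_less_imp_less) (use g n0 in simp)
                moreover have "(p2 + g2) * real n < real (m n)"
                  using N by (intro pos_less_divide_eq[OF n0, THEN iffD1]) blast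
                ultimately show ?thesis by (simp add: algebra_simps)
              qed
              have ct: "(count n k \<omega> - real n * Q.prob (cell (r n) k))\<^sup>2 \<le> real n * a" if k: "k \<in> F n" for k
              proof -
                have "(count n k \<omega> - real n * Q.prob (cell (r n) k))\<^sup>2 \<le> U (F n) (cell (r n)) \<omega>"
                  unfolding U_def count_def using k by (intro member_le_sum) (auto simp: F_def)
                also have "\<dots> \<le> real n * a" using nB elim(1) by (auto simp: B2_def)
                finally show ?thesis .
              qed
              have "\<bar>R n \<omega>\<bar> \<le> M * (r n)\<^sup>2"
                unfolding M_def
                using N by (intro good[OF n(1) elim(1) W _ _ _ elim(2) lo hi ct]) (auto simp: A_def a0 less_imp_le)
              then have "\<bar>R n \<omega> / (r n)\<^sup>2\<bar> \<le> M" using r by (simp add: abs_divide field_simps)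
              then show False using bad by simp
            qed
          qed
        qed
        ultimately show ?thesis using a1 pr1 pr2 pr3 pr4 small by linarith
      qed
      then show ?thesis by blast
    qed
  qed
qed

end
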